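(* Let $A$ be a $\sigma$-unital $C^*$-algebra and $H$ a countably generated Hilbert $A$-module. Suppose that $H_1$ and $H_2$ are Hilbert $A$-modules, $\phi: H\to H_1$ is a bounded module map and $s: H_2\to H_1$ is a surjective bounded module map. Then there exists a sequence of bounded module maps $\psi_n: H\to H_2$ such that $$\lim_{n\to\infty}\|s\circ\psi_n(x)-\phi(x)\|=0\quad\text{for all } x\in H.$$
   Context: Hilbert $A$-modules are right Hilbert $A$-modules. A bounded module map is a bounded $A$-linear map, not assumed to have an adjoint. A Hilbert $A$-module $H$ is countably generated if there is a countable subset $\mathcal F\subset H$ such that the linear span of $\{za: z\in\mathcal F, a\in A\}$ is norm dense in $H$. *)

theory Defs
  imports "HOL-Analysis.Analysis"
begin

text \<open>The distribution has type classes for real normed spaces only. The classes below add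
  multiplication by complex scalars, compatible with the real structure and the norm.\<close>

class scaleC =
  fixes scaleC :: "complex \<Rightarrow> 'a \<Rightarrow> 'a" (infixr "*\<^sub>C" 75)

class complex_vector = scaleC + real_vector +
  assumes scaleC_add_right: "c *\<^sub>C (x + y) = c *\<^sub>C x + c *\<^sub>C y"
    and scaleC_add_left: "(c + d) *\<^sub>C x = c *\<^sub>C x + d *\<^sub>C x"
    and scaleC_scaleC: "c *\<^sub>C d *\<^sub>C x = (c * d) *\<^sub>C x"
    and scaleC_of_real: "complex_of_real r *\<^sub>C x = r *\<^sub>R x"

class complex_normed_vector = complex_vector + real_normed_vector +
  assumes norm_scaleC: "norm (c *\<^sub>C x) = cmod c * norm x"

class complex_banach = complex_normed_vector + banach

lemma scaleC_one: "1 *\<^sub>C x = (x :: 'a::complex_vector)"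
  using scaleC_of_real[of 1 x] by simp

global_interpretation complex_vector: vector_space "scaleC :: complex \<Rightarrow> 'a \<Rightarrow> 'a::complex_vector"
  defines cspan = complex_vector.span
  by unfold_locales (simp_all add: scaleC_add_right scaleC_add_left scaleC_scaleC scaleC_one)

text \<open>A unit is not required, and the zero algebra is allowed.\<close>

class cstar_algebra = complex_banach + real_normed_algebra +
  fixes star :: "'a \<Rightarrow> 'a"
  assumes scaleC_mult_left: "(c *\<^sub>C a) * b = c *\<^sub>C (a * b)"
    and scaleC_mult_right: "a * (c *\<^sub>C b) = c *\<^sub>C (a * b)"
    and star_add: "star (a + b) = star a + star b"
    and star_scaleC: "star (c *\<^sub>C a) = cnj c *\<^sub>C star a"
    and star_mult: "star (a * b) = star b * star a"
    and star_star: "star (star a) = a"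
    and cstar_identity: "norm (star a * a) = (norm a)\<^sup>2"

definition cstar_pos :: "'a::cstar_algebra \<Rightarrow> bool" where
  "cstar_pos a \<longleftrightarrow> (\<exists>b. a = star b * b)"

definition cstar_le :: "'a::cstar_algebra \<Rightarrow> 'a \<Rightarrow> bool" where
  "cstar_le a b \<longleftrightarrow> cstar_pos (b - a)"

text \<open>A C*-algebra is sigma-unital if it has a sequential approximate unit, in the usual sense for
  C*-algebras: an increasing sequence of positive contractions.\<close>

definition sigma_unital :: "'a::cstar_algebra itself \<Rightarrow> bool" where
  "sigma_unital (_ :: 'a itself) \<longleftrightarrow>
    (\<exists>e :: nat \<Rightarrow> 'a.
      (\<forall>n. cstar_pos (e n) \<and> norm (e n) \<le> 1 \<and> cstar_le (e n) (e (Suc n))) \<and>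
      (\<forall>a. (\<lambda>n. e n * a) \<longlonglongrightarrow> a) \<and> (\<forall>a. (\<lambda>n. a * e n) \<longlonglongrightarrow> a))"

text \<open>Right modules, with the inner product linear in the second argument. Completeness comes from
  the class \<open>complex_banach\<close>, whose norm is tied to the inner product by \<open>norm_ip\<close>.\<close>

locale hilbert_module =
  fixes act :: "'h::complex_banach \<Rightarrow> 'a::cstar_algebra \<Rightarrow> 'h"
    and ip :: "'h \<Rightarrow> 'h \<Rightarrow> 'a"
  assumes act_add_left: "act (x + y) a = act x a + act y a"
    and act_add_right: "act x (a + b) = act x a + act x b"
    and act_mult: "act x (a * b) = act (act x a) b"
    and act_scaleC_left: "act (c *\<^sub>C x) a = c *\<^sub>C act x a"
    and act_scaleC_right: "act x (c *\<^sub>C a) = c *\<^sub>C act x a"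
    and ip_add_right: "ip x (y + z) = ip x y + ip x z"
    and ip_scaleC_right: "ip x (c *\<^sub>C y) = c *\<^sub>C ip x y"
    and ip_act_right: "ip x (act y a) = ip x y * a"
    and ip_star: "ip y x = star (ip x y)"
    and ip_pos: "cstar_pos (ip x x)"
    and ip_definite: "ip x x = 0 \<Longrightarrow> x = 0"
    and norm_ip: "norm x = sqrt (norm (ip x x))"

definition countably_generated :: "('h::complex_banach \<Rightarrow> 'a::cstar_algebra \<Rightarrow> 'h) \<Rightarrow> bool" where
  "countably_generated act \<longleftrightarrow>
    (\<exists>F. countable F \<and> closure (cspan {act z a |z a. z \<in> F}) = UNIV)"

text \<open>Bounded module maps need not have an adjoint.\<close>

definition bounded_module_map ::
  "('h::complex_banach \<Rightarrow> 'a::cstar_algebra \<Rightarrow> 'h) \<Rightarrow> ('k::complex_banach \<Rightarrow> 'a \<Rightarrow> 'k) \<Rightarrow>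
    ('h \<Rightarrow> 'k) \<Rightarrow> bool" where
  "bounded_module_map act act' f \<longleftrightarrow>
    bounded_linear f \<and> (\<forall>c x. f (c *\<^sub>C x) = c *\<^sub>C f x) \<and> (\<forall>x a. f (act x a) = act' (f x) a)"

end

theory Submission
  imports Defs
begin

text \<open>If finite sums \<open>K\<^sub>n\<close> of rank one maps \<open>z \<mapsto> x \<langle>y, z\<rangle>\<close> converge strongly to the identity of \<open>H\<close>, then
  lifting the vectors \<open>\<phi> x\<close> along \<open>s\<close> turns \<open>\<phi> \<circ> K\<^sub>n\<close> into \<open>s \<circ> \<psi>\<^sub>n\<close>. For generators \<open>x\<^sub>i\<close> in the unit ball,
  \<open>C\<^sub>n z = z - (1/(n+1)) (\<Sum>i\<le>n. x\<^sub>i \<langle>x\<^sub>i, z\<rangle>)\<close> is a self-adjoint contraction. Take \<open>K\<^sub>n = 1 - M\<^sub>n\<close> where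
  \<open>M\<^sub>n\<close> is the mean of the first \<open>m\<close> powers of \<open>C\<^sub>n\<close>: as \<open>(1 - C\<^sub>n) M\<^sub>n\<close> has norm at most \<open>2/m\<close>, the vectors
  \<open>M\<^sub>n x\<^sub>i\<close> with \<open>i \<le> n\<close> are small for large \<open>m\<close>. The order arguments rest on the positivity of sums of
  elements \<open>star b * b\<close>, that is, on Kaplansky's theorem, which is applied in the unitization.\<close>

section \<open>Positivity in unital C*-algebras\<close>

lemma star_scaleR: "star (r *\<^sub>R a) = r *\<^sub>R star (a :: 'a::cstar_algebra)"
  using star_scaleC[of "complex_of_real r" a] by (simp add: scaleC_of_real)

lemma star_zero [simp]: "star (0 :: 'a::cstar_algebra) = 0"
  using star_add[of 0 "0::'a"] by simp

lemma star_minus: "star (- a) = - star (a :: 'a::cstar_algebra)"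
  using star_add[of a "- a"] by (simp add: add_eq_0_iff)

lemma star_diff: "star (a - b) = star a - star (b :: 'a::cstar_algebra)"
  using star_add[of a "- b"] by (simp add: star_minus)

lemma norm_star [simp]: "norm (star a) = norm (a :: 'a::cstar_algebra)"
proof -
  have le: "norm b \<le> norm (star b)" for b :: 'a
  proof (cases "b = 0")
    case False
    have "norm b * norm b \<le> norm (star b) * norm b"
      using cstar_identity[of b] norm_mult_ineq[of "star b" b] by (simp add: power2_eq_square)
    then show ?thesis using False by simp
  qed simp
  show ?thesis using le[of a] le[of "star a"] by (simp add: star_star)
qed

lemma bounded_linear_star: "bounded_linear (star :: 'a::cstar_algebra \<Rightarrow> 'a)"
  by (rule bounded_linear_intro[where K = 1]) (simp_all add: star_add star_scaleR)

lemma norm_selfadjoint_square: "star a = a \<Longrightarrow> norm (a * a) = (norm (a :: 'a::cstar_algebra))\<^sup>2"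
  using cstar_identity[of a] by simp

text \<open>The condition \<open>norm 1 = 1\<close> excludes the zero algebra. The unitization meets
  it always, even over the zero algebra.\<close>

class unital_cstar_algebra = cstar_algebra + real_normed_algebra_1

lemma star_one [simp]: "star (1 :: 'a::unital_cstar_algebra) = 1"
  using star_mult[of "star (1::'a)" 1] by (simp add: star_star)

lemma star_of_real [simp]: "star (of_real r :: 'a::unital_cstar_algebra) = of_real r"
  by (simp add: of_real_def star_scaleR)

lemma star_power: "star (a ^ n) = star (a :: 'a::unital_cstar_algebra) ^ n"
  by (induction n) (simp_all add: star_mult power_commutes)

text \<open>Repeated squaring by the C*-identity. This takes the place of the spectral radius
  formula.\<close>

lemma norm_selfadjoint_power:
  "star a = a \<Longrightarrow> norm (a ^ 2 ^ m) = norm (a :: 'a::unital_cstar_algebra) ^ 2 ^ m"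
proof (induction m)
  case (Suc m)
  have "norm (a ^ 2 ^ Suc m) = norm (a ^ 2 ^ m * a ^ 2 ^ m)"
    by (simp add: power_add mult_2)
  also have "\<dots> = (norm (a ^ 2 ^ m))\<^sup>2"
    by (rule norm_selfadjoint_square) (simp add: star_power Suc.prems)
  finally show ?case using Suc by (simp add: power_mult[symmetric] mult.commute)
qed simp

text \<open>The equation for \<open>y\<close> says \<open>2 y = k + y * y\<close>, so
  \<open>y\<close> is a fixed point of \<open>f\<close>, which contracts by the factor
  \<open>norm k\<close> on the ball of that radius. Self-adjointness and commutation with the
  commutant of \<open>k\<close> are closed conditions preserved by \<open>f\<close>, so they are
  built into \<open>Y\<close>.\<close>

lemma sqrt_near_one:
  fixes k :: "'a::unital_cstar_algebra"
  assumes "star k = k" "norm k < 1"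
  obtains y where "star y = y" "norm y < 1" "(1 - y) * (1 - y) = 1 - k"
    "\<And>c. c * k = k * c \<Longrightarrow> c * y = y * c"
proof -
  define Y where "Y = {y. star y = y \<and> norm y \<le> norm k \<and> (\<forall>c. c * k = k * c \<longrightarrow> c * y = y * c)}"
  define f where "f y = (1/2) *\<^sub>R (k + y * y)" for y
  have Y_eq: "Y = {y. star y = y} \<inter> {y. norm y \<le> norm k} \<inter> (\<Inter>c\<in>{c. c * k = k * c}. {y. c * y = y * c})"
    by (auto simp: Y_def)
  have "closed Y"
    unfolding Y_eq
    by (intro closed_Int closed_INT ballI closed_Collect_eq closed_Collect_le continuous_intros
        linear_continuous_on bounded_linear_star)
  then have "complete Y" by (simp add: complete_eq_closed)
  moreover have "0 \<in> Y" by (simp add: Y_def)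
  then have "Y \<noteq> {}" by blast
  moreover have "f ` Y \<subseteq> Y"
  proof clarify
    fix y assume y: "y \<in> Y"
    have "norm (k + y * y) \<le> norm k + norm y * norm y"
      by (meson norm_triangle_le add_left_mono norm_mult_ineq)
    also have "\<dots> \<le> norm k + norm k * 1"
      using y assms by (intro add_left_mono mult_mono) (auto simp: Y_def)
    finally have "norm (f y) \<le> norm k" by (simp add: f_def)
    moreover have "c * f y = f y * c" if "c * k = k * c" for c
    proof -
      have "c * y = y * c" using that y by (auto simp: Y_def)
      then have "c * (y * y) = y * y * c" by (metis mult.assoc)
      then show ?thesis using that by (simp add: f_def algebra_simps)
    qed
    moreover have "star y = y" using y by (simp add: Y_def)
    then have "star (f y) = f y" by (simp add: f_def star_scaleR star_add star_mult assms)
    ultimately show "f y \<in> Y" unfolding Y_def by blast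
  qed
  moreover have "dist (f x) (f y) \<le> norm k * dist x y" if xy: "x \<in> Y" "y \<in> Y" for x y
  proof -
    have "f x - f y = (1/2) *\<^sub>R (x * (x - y) + (x - y) * y)"
      by (simp add: f_def algebra_simps)
    then have "norm (f x - f y) = (1/2) * norm (x * (x - y) + (x - y) * y)" by simp
    also have "norm (x * (x - y) + (x - y) * y) \<le> norm x * norm (x - y) + norm (x - y) * norm y"
      by (meson norm_triangle_le add_mono norm_mult_ineq)
    also have "\<dots> \<le> norm k * norm (x - y) + norm (x - y) * norm k"
      using xy by (intro add_mono mult_mono) (auto simp: Y_def)
    finally show ?thesis by (simp add: dist_norm)
  qed
  ultimately obtain y where y: "y \<in> Y" "f y = y"
    using Banach_fix[of Y "norm k" f] assms(2) norm_ge_zero[of k] by metis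
  have "k + y * y = 2 *\<^sub>R f y" by (simp add: f_def)
  then have "(1 - y) * (1 - y) = 1 - k"
    using y by (simp add: algebra_simps scaleR_2)
  with y assms that[of y] show thesis unfolding Y_def by force
qed

text \<open>Positivity in the sense of Kelley and Vaught: with this choice sums of positive elements are
  trivially positive, and the burden moves to the positivity of \<open>star c * c\<close>.\<close>

definition kv_pos :: "'a::unital_cstar_algebra \<Rightarrow> bool" where
  "kv_pos h \<longleftrightarrow> star h = h \<and> (\<exists>t\<ge>0. norm (of_real t - h) \<le> t)"

lemma kv_pos_selfadjoint: "kv_pos h \<Longrightarrow> star h = h"
  by (simp add: kv_pos_def)

text \<open>Enlarging \<open>t\<close> preserves the inequality, so the witness may be taken as
  large as an argument requires.\<close>

lemma kv_pos_ge:
  assumes "kv_pos h"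
  obtains t where "t \<ge> r" "norm (of_real t - h) \<le> t"
proof -
  obtain t where t: "t \<ge> 0" "norm (of_real t - h) \<le> t" using assms by (auto simp: kv_pos_def)
  have "norm (of_real (t + \<bar>r\<bar>) - h) = norm (of_real \<bar>r\<bar> + (of_real t - h))"
    by (simp add: algebra_simps)
  also have "\<dots> \<le> \<bar>r\<bar> + t" using t by (intro norm_triangle_le) (simp add: norm_of_real)
  finally show thesis using t by (intro that[of "t + \<bar>r\<bar>"]) auto
qed

lemma kv_pos_add:
  assumes "kv_pos h" "kv_pos k" shows "kv_pos (h + k)"
proof -
  obtain t u where tu: "t \<ge> 0" "norm (of_real t - h) \<le> t" "u \<ge> 0" "norm (of_real u - k) \<le> u"
    using assms by (auto simp: kv_pos_def)
  have "norm (of_real (t + u) - (h + k)) = norm ((of_real t - h) + (of_real u - k))"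
    by (simp add: algebra_simps)
  also have "\<dots> \<le> t + u" using tu by (intro norm_triangle_le) simp
  finally show ?thesis using assms tu unfolding kv_pos_def
    by (intro conjI exI[of _ "t + u"]) (auto simp: star_add)
qed

lemma kv_pos_of_real_diff:
  assumes "star h = h" "norm h \<le> r" shows "kv_pos (of_real r - h)"
  using assms unfolding kv_pos_def
  by (intro conjI exI[of _ r]) (auto simp: star_diff intro: order_trans[OF norm_ge_zero])

text \<open>The shift by \<open>e\<close> moves \<open>h\<close> off the boundary:
  \<open>h + e = u (1 - k)\<close> with \<open>u = t + e\<close> and \<open>norm k < 1\<close>, so
  \<open>sqrt_near_one\<close> applies. Applications let \<open>e\<close> tend to 0 or absorb it in
  an error term.\<close>

lemma kv_pos_sqrt:
  assumes "kv_pos h" "e > 0"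
  obtains a where "kv_pos a" "a * a = h + of_real e" "\<And>c. c * h = h * c \<Longrightarrow> c * a = a * c"
proof -
  obtain t where t: "t \<ge> 0" "norm (of_real t - h) \<le> t" using assms by (auto simp: kv_pos_def)
  define u where "u = t + e"
  have u: "u > 0" "t < u" using t assms by (auto simp: u_def)
  define k where "k = (1/u) *\<^sub>R (of_real t - h)"
  have uk: "u *\<^sub>R k = of_real t - h" using u by (simp add: k_def)
  have "star k = k" using assms by (simp add: k_def kv_pos_def star_scaleR star_diff)
  moreover have "norm k < 1" using t u by (simp add: k_def divide_simps)
  ultimately obtain y where y: "star y = y" "norm y < 1" "(1 - y) * (1 - y) = 1 - k"
    "\<And>c. c * k = k * c \<Longrightarrow> c * y = y * c" by (rule sqrt_near_one) blast
  define a where "a = of_real (sqrt u) - sqrt u *\<^sub>R y"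
  have a: "a = sqrt u *\<^sub>R (1 - y)" by (simp add: a_def of_real_def algebra_simps)
  have "kv_pos a" unfolding a_def using y u
    by (intro kv_pos_of_real_diff) (auto simp: star_scaleR mult_left_le)
  moreover have "a * a = u *\<^sub>R (1 - k)" using u y by (simp add: a)
  then have "a * a = h + of_real e" by (simp add: scaleR_diff_right uk) (simp add: u_def of_real_def algebra_simps)
  moreover have "c * a = a * c" if "c * h = h * c" for c
  proof -
    have "c * k = k * c" using that by (simp add: k_def of_real_def algebra_simps)
    then have "c * y = y * c" by (rule y(4))
    then show ?thesis by (simp add: a algebra_simps)
  qed
  ultimately show thesis by (rule that)
qed

text \<open>The element \<open>a + i sqrt (1 - a\<^sup>2)\<close> is unitary, so its imaginary part is a contraction.\<close>

lemma norm_one_minus_square: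
  fixes a :: "'a::unital_cstar_algebra"
  assumes sa: "star a = a" and "norm a < 1"
  shows "norm (1 - a * a) \<le> 1"
proof -
  have "norm (a * a) < 1" using assms by (simp add: norm_selfadjoint_square power_less_one_iff)
  moreover have "star (a * a) = a * a" using assms by (simp add: star_mult)
  ultimately obtain y where y: "star y = y" "(1 - y) * (1 - y) = 1 - a * a"
    and comm: "\<And>c. c * (a * a) = (a * a) * c \<Longrightarrow> c * y = y * c"
    by (metis sqrt_near_one)
  define b where "b = 1 - y"
  \<comment> \<open>Taking \<open>c = a\<close> in \<open>comm\<close> makes \<open>a\<close> and
    \<open>b\<close> commute, which cancels the cross terms of \<open>star w * w\<close>.\<close>
  have b: "star b = b" "b * b = 1 - a * a" "a * b = b * a"
    using y comm[of a] by (auto simp: b_def star_diff algebra_simps)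
  define w where "w = a + \<i> *\<^sub>C b"
  have sw: "star w = a - \<i> *\<^sub>C b"
    by (simp add: w_def star_add star_scaleC b sa complex_vector.scale_minus_left)
  have "star w * w = a * a + b * b"
    unfolding sw unfolding w_def
    by (simp add: algebra_simps scaleC_mult_left scaleC_mult_right scaleC_scaleC b(3)
        complex_vector.scale_minus_left scaleC_one)
  then have "norm w = 1" using cstar_identity[of w] b
    by (simp add: power2_eq_1_iff) (use norm_ge_zero[of w] in linarith)
  moreover have "2 *\<^sub>R b = (- \<i>) *\<^sub>C (w - star w)"
    unfolding sw unfolding w_def
    by (simp add: complex_vector.scale_right_distrib complex_vector.scale_right_diff_distrib
        scaleC_scaleC scaleC_one scaleR_2)
  then have "2 * norm b = norm (w - star w)"
    by (metis abs_numeral norm_scaleC norm_scaleR norm_minus_cancel norm_ii mult_1)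
  then have "2 * norm b \<le> norm w + norm (star w)" by (simp add: norm_triangle_ineq4 del: norm_star)
  ultimately have "norm b \<le> 1" by simp
  then show ?thesis using norm_selfadjoint_square[OF b(1)] b(2) by (simp add: power_le_one)
qed

text \<open>The preceding lemma, rescaled by \<open>sqrt t\<close>. The explicit threshold for
  \<open>t\<close> lets \<open>kv_pos_closed\<close> use one \<open>t\<close> for all small
  perturbations.\<close>

lemma norm_of_real_minus_square:
  fixes a :: "'a::unital_cstar_algebra"
  assumes sa: "star a = a" and "(norm a)\<^sup>2 < t"
  shows "norm (of_real t - a * a) \<le> t"
proof -
  have t: "t > 0" using assms by (meson le_less_trans zero_le_power2)
  define b where "b = (1 / sqrt t) *\<^sub>R a"
  have "norm a < sqrt t" using assms t by (simp add: real_less_rsqrt)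
  then have "norm b < 1" using t by (simp add: b_def divide_simps)
  then have "norm (1 - b * b) \<le> 1" using sa by (intro norm_one_minus_square) (simp_all add: b_def star_scaleR)
  moreover have "of_real t - a * a = t *\<^sub>R (1 - b * b)"
    using t by (simp add: b_def of_real_def algebra_simps)
  ultimately show ?thesis using t by simp
qed

lemma kv_pos_square:
  assumes "star a = a" shows "kv_pos (a * a)"
  using norm_of_real_minus_square[of a "(norm a)\<^sup>2 + 1"] assms
  unfolding kv_pos_def by (intro conjI exI[of _ "(norm a)\<^sup>2 + 1"]) (auto simp: star_mult)

text \<open>Since \<open>a\<close> and \<open>b\<close> commute, \<open>w = a + i b\<close>
  satisfies \<open>star w * w = a * a + b * b\<close>, and the real part \<open>a\<close> of
  \<open>w\<close> has norm at most \<open>norm w\<close>.\<close>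

lemma norm_le_sum_squares:
  fixes a b :: "'a::unital_cstar_algebra"
  assumes "star a = a" "star b = b" "a * b = b * a"
  shows "(norm a)\<^sup>2 \<le> norm (a * a + b * b)"
proof -
  define w where "w = a + \<i> *\<^sub>C b"
  have sw: "star w = a - \<i> *\<^sub>C b"
    by (simp add: w_def star_add star_scaleC assms complex_vector.scale_minus_left)
  have "star w * w = a * a + b * b"
    unfolding sw unfolding w_def
    by (simp add: algebra_simps scaleC_mult_left scaleC_mult_right scaleC_scaleC assms(3)
        complex_vector.scale_minus_left scaleC_one)
  then have "(norm w)\<^sup>2 = norm (a * a + b * b)" using cstar_identity[of w] by simp
  moreover have "2 *\<^sub>R a = w + star w" unfolding sw unfolding w_def by (simp add: scaleR_2)
  then have "2 * norm a = norm (w + star w)" by (metis abs_numeral norm_scaleR)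
  then have "2 * norm a \<le> norm w + norm (star w)" by (simp add: norm_triangle_ineq del: norm_star)
  then have "norm a \<le> norm w" by simp
  ultimately show ?thesis by (metis norm_ge_zero power_mono)
qed

text \<open>Approximate square roots of \<open>p\<close> and \<open>q\<close> commute, by two uses
  of the commutation clause of \<open>kv_pos_sqrt\<close>; this reduces the claim to sums of
  squares.\<close>

lemma norm_le_norm_add_commuting:
  assumes "kv_pos p" "kv_pos q" "p * q = q * p"
  shows "norm p \<le> norm (p + q)"
proof (rule field_le_epsilon)
  fix d :: real assume "d > 0"
  \<comment> \<open>The total error is \<open>3 * e\<close>: twice \<open>e\<close> from the shifts
    of \<open>p\<close> and \<open>q\<close>, once from removing the shift of \<open>p\<close> on
    the left.\<close>
  define e where "e = d / 3"
  have e: "e > 0" using \<open>d > 0\<close> by (simp add: e_def)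
  obtain a where a: "kv_pos a" "a * a = p + of_real e" "\<And>c. c * p = p * c \<Longrightarrow> c * a = a * c"
    using kv_pos_sqrt[OF assms(1) e] by blast
  obtain b where b: "kv_pos b" "b * b = q + of_real e" "\<And>c. c * q = q * c \<Longrightarrow> c * b = b * c"
    using kv_pos_sqrt[OF assms(2) e] by blast
  have "q * a = a * q" using a(3)[of q] assms(3) by simp
  then have "a * b = b * a" using b(3) by metis
  then have "(norm a)\<^sup>2 \<le> norm (a * a + b * b)"
    by (intro norm_le_sum_squares kv_pos_selfadjoint a(1) b(1))
  moreover have "(norm a)\<^sup>2 = norm (a * a)"
    by (rule norm_selfadjoint_square[OF kv_pos_selfadjoint[OF a(1)], symmetric])
  moreover have "a * a + b * b = (p + q) + of_real (2 * e)"
    by (simp only: a(2) b(2) mult_2 of_real_add add_ac)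
  ultimately have "norm (p + of_real e) \<le> norm ((p + q) + of_real (2 * e))"
    unfolding a(2)[symmetric] by simp
  also have "\<dots> \<le> norm (p + q) + norm (of_real (2 * e) :: 'a)" by (rule norm_triangle_ineq)
  finally have "norm (p + of_real e) \<le> norm (p + q) + 2 * e" using e unfolding norm_of_real by simp
  moreover have "norm p \<le> norm (p + of_real e) + e"
    using norm_triangle_ineq4[of "p + of_real e" "of_real e"] e by (simp add: norm_of_real)
  ultimately show "norm p \<le> norm (p + q) + d" by (simp add: e_def)
qed

text \<open>With \<open>t = norm (p + q)\<close>, the element
  \<open>t - p = (t - (p + q)) + q\<close> is positive and commutes with \<open>p\<close>, and
  \<open>p + (t - p)\<close> is the scalar \<open>t\<close>.\<close>

lemma norm_le_norm_add:
  assumes "kv_pos p" "kv_pos q"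
  shows "norm p \<le> norm (p + q)"
proof -
  define t where "t = norm (p + q)"
  have "kv_pos (of_real t - (p + q))"
    using assms by (intro kv_pos_of_real_diff) (auto simp: kv_pos_def t_def star_add)
  then have "kv_pos ((of_real t - (p + q)) + q)" using assms by (intro kv_pos_add)
  then have "kv_pos (of_real t - p)" by simp
  moreover have "p * (of_real t - p) = (of_real t - p) * p" by (simp add: of_real_def algebra_simps)
  ultimately have "norm p \<le> norm (p + (of_real t - p))"
    using assms by (intro norm_le_norm_add_commuting)
  then show ?thesis by (simp add: norm_of_real t_def)
qed

text \<open>The witnesses for \<open>h + e\<close> might grow as \<open>e\<close> tends to 0.
  Writing \<open>h + 2 e\<close> as a square replaces them by the fixed witness
  \<open>norm h + 1\<close>.\<close>

lemma kv_pos_closed: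
  assumes "\<And>e. e > 0 \<Longrightarrow> kv_pos (h + of_real e)"
  shows "kv_pos h"
proof -
  have "star (h + of_real 1) = h + of_real 1" using assms[of 1] by (simp only: kv_pos_def)
  then have sa: "star h = h" by (simp add: star_add)
  define t where "t = norm h + 1"
  have "norm (of_real t - h) \<le> t + d" if "d > 0" for d
  proof -
    \<comment> \<open>\<open>2 * e < 1\<close> keeps \<open>(norm a)\<^sup>2\<close> below
      \<open>t\<close>, and \<open>2 * e \<le> d\<close> bounds the error. One \<open>e\<close>
      comes from the hypothesis, the other from the square root.\<close>
    define e where "e = min d (1/2) / 2"
    have e: "e > 0" "2 * e < 1" "2 * e \<le> d" using \<open>d > 0\<close> by (auto simp: e_def min_def)
    obtain a where a: "kv_pos a" "a * a = h + of_real e + of_real e"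
      using kv_pos_sqrt[OF assms[OF e(1)] e(1)] by blast
    have aa: "a * a = h + of_real (2 * e)" by (simp only: a of_real_add mult_2 add.assoc)
    have "norm (h + of_real (2 * e)) \<le> norm h + norm (of_real (2 * e) :: 'a)"
      by (rule norm_triangle_ineq)
    also have "\<dots> < t" using e unfolding norm_of_real t_def by simp
    finally have "(norm a)\<^sup>2 < t" using a(1) aa
      by (simp only: norm_selfadjoint_square[symmetric] kv_pos_def)
    then have "norm (of_real t - a * a) \<le> t"
      using a(1) by (intro norm_of_real_minus_square) (simp_all add: kv_pos_def)
    moreover have "norm (of_real t - h) \<le> norm (of_real t - a * a) + norm (of_real (2 * e) :: 'a)"
      using norm_triangle_ineq[of "of_real t - a * a" "of_real (2 * e)"] unfolding aa by (simp only: diff_add_eq add_diff_cancel_right)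
    ultimately show ?thesis using e unfolding norm_of_real by simp
  qed
  then have "norm (of_real t - h) \<le> t" by (rule field_le_epsilon)
  then show ?thesis using sa unfolding kv_pos_def t_def by (intro conjI exI[of _ "norm h + 1"]) auto
qed

text \<open>If \<open>q = 1 + d\<close> with \<open>d > 0\<close>, squaring Bernoulli's inequality
  gives growth quadratic in \<open>2 ^ m\<close>, which exceeds the linear bound.\<close>

lemma le_one_if_powers_linear:
  fixes q :: real
  assumes "q \<ge> 0" "\<And>m. q ^ 2 ^ m \<le> 1 + 2 ^ m * K"
  shows "q \<le> 1"
proof (rule ccontr)
  assume "\<not> q \<le> 1"
  define d where "d = q - 1"
  have d: "d > 0" using \<open>\<not> q \<le> 1\<close> by (simp add: d_def)
  have lin: "2 * d + 2 ^ m * d\<^sup>2 \<le> 2 * K" for m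
  proof -
    have b: "1 + 2 ^ m * d \<le> q ^ 2 ^ m"
      using Bernoulli_inequality[of d "2 ^ m"] d by (simp add: d_def)
    have "(1 + 2 ^ m * d)\<^sup>2 \<le> (q ^ 2 ^ m)\<^sup>2"
      using b d by (intro power_mono) auto
    also have "\<dots> = q ^ 2 ^ Suc m" by (simp add: power_mult[symmetric] mult.commute)
    also have "\<dots> \<le> 1 + 2 ^ Suc m * K" by (rule assms)
    finally have "2 ^ m * (2 * d + 2 ^ m * d\<^sup>2) \<le> 2 ^ m * (2 * K)"
      by (simp add: power2_eq_square algebra_simps)
    then show ?thesis by simp
  qed
  obtain n :: nat where "2 * K / d\<^sup>2 < of_nat n" using reals_Archimedean2 by blast
  also have "real n < 2 ^ n" by (rule of_nat_less_two_power)
  finally have "2 * K < 2 ^ n * d\<^sup>2" using d by (simp add: divide_simps)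
  with lin[of n] d show False by simp
qed

text \<open>The powers of \<open>s + c star c\<close> are controlled by those of \<open>s + star c c\<close>, and for
  self-adjoint elements the norm is the growth rate of the powers.\<close>

lemma norm_add_mult_star_le:
  fixes c :: "'a::unital_cstar_algebra"
  assumes "0 \<le> s" "s \<le> t" "t > 0" "norm (of_real s + star c * c) \<le> t"
  shows "norm (of_real s + c * star c) \<le> t"
proof -
  define P Q where "P = of_real s + c * star c" and "Q = of_real s + star c * c"
  \<comment> \<open>Each further power of \<open>P\<close> adds a term of norm at most
    \<open>(norm c)\<^sup>2 * t ^ n = t ^ Suc n * K\<close>.\<close>
  define K where "K = (norm c)\<^sup>2 / t"
  have "P * c = c * Q" by (simp add: P_def Q_def of_real_def algebra_simps)
  then have comm: "P ^ n * c = c * Q ^ n" for n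
    by (induction n) (simp_all add: mult.assoc power_commutes, metis mult.assoc power_commutes)
  have Qn: "norm (Q ^ n) \<le> t ^ n" for n
    using assms by (intro order_trans[OF norm_power_ineq] power_mono) (auto simp: Q_def)
  have bound: "norm (P ^ n) \<le> t ^ n * (1 + of_nat n * K)" for n
  proof (induction n)
    case (Suc n)
    have "P ^ Suc n = P ^ n * P" by (simp add: power_commutes)
    also have "\<dots> = s *\<^sub>R P ^ n + c * Q ^ n * star c"
      unfolding comm[symmetric] by (subst (2) P_def) (simp add: distrib_left of_real_def mult.assoc)
    finally have "norm (P ^ Suc n) \<le> s * norm (P ^ n) + norm (c * Q ^ n * star c)"
      using assms norm_triangle_ineq[of "s *\<^sub>R P ^ n" "c * Q ^ n * star c"] by simp
    also have "norm (c * Q ^ n * star c) \<le> norm c * norm (Q ^ n) * norm (star c)"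
      by (meson norm_mult_ineq order_trans mult_right_mono norm_ge_zero)
    also have "\<dots> \<le> norm c * t ^ n * norm (star c)"
      by (intro mult_right_mono mult_left_mono Qn) auto
    also have "s * norm (P ^ n) \<le> t * (t ^ n * (1 + of_nat n * K))"
      using assms by (intro mult_mono Suc) auto
    also have "t * (t ^ n * (1 + of_nat n * K)) + norm c * t ^ n * norm (star c)
        = t ^ Suc n * (1 + of_nat (Suc n) * K)"
      using assms by (simp add: K_def field_simps power2_eq_square)
    finally show ?case by simp
  qed simp
  have "star P = P" by (simp add: P_def star_add star_mult star_star)
  have "norm P / t \<le> 1"
  proof (rule le_one_if_powers_linear)
    fix m :: nat
    have "norm P ^ 2 ^ m \<le> t ^ 2 ^ m * (1 + 2 ^ m * K)"
      using bound[of "2 ^ m"] norm_selfadjoint_power[OF \<open>star P = P\<close>] by simp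
    then show "(norm P / t) ^ 2 ^ m \<le> 1 + 2 ^ m * K"
      using assms by (simp add: power_divide divide_simps mult.commute)
  qed (use assms in simp)
  then show ?thesis using assms by (simp add: P_def)
qed

text \<open>An elementary substitute for the fact that \<open>star c * c\<close> and
  \<open>c * star c\<close> have the same nonzero spectrum.\<close>

lemma kv_pos_diff_mult_star:
  fixes c :: "'a::unital_cstar_algebra"
  assumes "kv_pos (of_real d - star c * c)" "d \<ge> 0"
  shows "kv_pos (of_real d - c * star c)"
proof -
  \<comment> \<open>With \<open>t \<ge> d + 1\<close>, the scalar \<open>t - d\<close> is
    nonnegative and \<open>t\<close> is positive, as \<open>norm_add_mult_star_le\<close>
    requires.\<close>
  obtain t where t: "t \<ge> d + 1" "norm (of_real t - (of_real d - star c * c)) \<le> t"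
    using assms(1) by (rule kv_pos_ge)
  have eq: "of_real t - (of_real d - x) = of_real (t - d) + x" for x :: 'a by simp
  have "norm (of_real (t - d) + c * star c) \<le> t"
    using t assms by (intro norm_add_mult_star_le) (auto simp only: eq)
  then show ?thesis using t assms unfolding kv_pos_def
    by (intro conjI exI[of _ t]) (auto simp only: eq star_diff star_mult star_star star_of_real)
qed

text \<open>The sum is twice the sum of the squares of the real and imaginary parts of
  \<open>d\<close>; up to sign, \<open>p\<close> and \<open>q\<close> are these parts times
  \<open>sqrt 2\<close>.\<close>

lemma kv_pos_star_mult_add_mult_star:
  fixes d :: "'a::unital_cstar_algebra"
  shows "kv_pos (star d * d + d * star d)"
proof -
  define r where "r = sqrt (1/2)"
  have r: "r * r = 1/2" by (simp add: r_def)
  define p q where "p = r *\<^sub>R (d + star d)" and "q = \<i> *\<^sub>C (r *\<^sub>R (d - star d))"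
  have "star p = p" by (simp add: p_def star_scaleR star_add star_star add.commute)
  have "star q = q"
    by (simp add: q_def star_scaleC star_scaleR star_diff star_star complex_vector.scale_minus_left
        flip: complex_vector.scale_minus_right scaleR_minus_right)
  have "q * q = - ((r *\<^sub>R (d - star d)) * (r *\<^sub>R (d - star d)))"
    by (simp only: q_def scaleC_mult_left scaleC_mult_right scaleC_scaleC)
      (simp add: complex_vector.scale_minus_left scaleC_one)
  then have "p * p + q * q = (r * r) *\<^sub>R ((d + star d) * (d + star d) - (d - star d) * (d - star d))"
    by (simp only: p_def mult_scaleR_left mult_scaleR_right scaleR_scaleR scaleR_diff_right[of "r * r"]) simp
  also have "(d + star d) * (d + star d) - (d - star d) * (d - star d) = 2 *\<^sub>R (star d * d + d * star d)"
    by (simp add: algebra_simps scaleR_2)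
  finally have "p * p + q * q = star d * d + d * star d" by (simp add: r)
  moreover have "kv_pos (p * p + q * q)"
    using \<open>star p = p\<close> \<open>star q = q\<close> by (intro kv_pos_add kv_pos_square)
  ultimately show ?thesis by simp
qed

text \<open>Quantitative form of the fact that \<open>d = 0\<close> if \<open>- (star d * d)\<close>
  is positive. Exchanging the factors and adding shows that \<open>e + ?k\<close> is positive as
  well; it commutes with \<open>e - ?k\<close>, and the two add up to \<open>2 * e\<close>.\<close>

lemma norm_le_if_kv_pos_diff_star_mult:
  fixes d :: "'a::unital_cstar_algebra"
  assumes "kv_pos (of_real e - star d * d)" "e \<ge> 0"
  shows "norm (star d * d) \<le> 3 * e"
proof -
  let ?k = "star d * d"
  have "kv_pos ((of_real e - d * star d) + (star d * d + d * star d))"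
    using assms by (intro kv_pos_add kv_pos_diff_mult_star kv_pos_star_mult_add_mult_star)
  then have "kv_pos (of_real e + ?k)" by (simp add: algebra_simps)
  moreover have "(of_real e - ?k) * (of_real e + ?k) = (of_real e + ?k) * (of_real e - ?k)"
    by (simp add: of_real_def algebra_simps)
  ultimately have "norm (of_real e - ?k) \<le> norm ((of_real e - ?k) + (of_real e + ?k))"
    using assms by (intro norm_le_norm_add_commuting)
  also have "(of_real e - ?k) + (of_real e + ?k) = of_real (2 * e)"
    by (simp only: mult_2 of_real_add) simp
  finally have "norm (of_real e - ?k) \<le> 2 * e" using assms unfolding norm_of_real by simp
  then show ?thesis
    using norm_triangle_ineq4[of "of_real e" "of_real e - ?k"] assms by (simp add: norm_of_real)
qed

text \<open>Kaplansky's argument with \<open>y = sqrt (h\<^sup>2 + e) - h\<close> in place of twice the negative part of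
  \<open>h = star c * c\<close>: up to terms of order \<open>e\<close>, the element \<open>star (c * y) * (c * y) = y * h * y\<close> is
  negative, hence small, and \<open>y\<^sup>3\<close> is small with it.\<close>

theorem kv_pos_star_mult:
  fixes c :: "'a::unital_cstar_algebra"
  shows "kv_pos (star c * c)"
proof (rule kv_pos_closed)
  fix \<eta> :: real assume \<eta>: "\<eta> > 0"
  define h where "h = star c * c"
  \<comment> \<open>\<open>M\<close> will bound \<open>norm y\<close>, as \<open>e \<le> 1\<close>
    gives \<open>norm a \<le> norm h + 1\<close>. The product \<open>e * K\<close> will bound
    \<open>norm (y * y * y)\<close>, and \<open>e\<close> is chosen to bring it below
    \<open>\<eta> ^ 3\<close>.\<close>
  define M where "M = 2 * norm h + 1"
  define K where "K = M + 6 * (M\<^sup>2 + M)"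
  define e where "e = min 1 (\<eta> ^ 3 / K)"
  have M: "M \<ge> 1" by (simp add: M_def)
  then have K: "K > 0" by (auto simp: K_def intro!: add_pos_nonneg)
  have e: "e > 0" "e \<le> 1" "e * K \<le> \<eta> ^ 3" using K \<eta> by (auto simp: e_def min_def field_simps)
  have sh: "star h = h" by (simp add: h_def star_mult star_star)
  obtain a where a: "kv_pos a" "a * a = h * h + of_real e"
    "\<And>x. x * (h * h) = (h * h) * x \<Longrightarrow> x * a = a * x"
    using kv_pos_sqrt[OF kv_pos_square[OF sh] e(1)] by blast
  have ha: "h * a = a * h" using a(3)[of h] by (simp add: mult.assoc)
  obtain b where b: "kv_pos b" "b * b = a + of_real e" "\<And>x. x * a = a * x \<Longrightarrow> x * b = b * x"
    using kv_pos_sqrt[OF a(1) e(1)] by blast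
  have sa: "star a = a" and sb: "star b = b"
    using kv_pos_selfadjoint[OF a(1)] kv_pos_selfadjoint[OF b(1)] .
  define y where "y = a - h"
  have sy: "star y = y" by (simp add: y_def star_diff sa sh)
  have ya: "y * a = a * y" using ha by (simp add: y_def algebra_simps)
  have yb: "y * b = b * y" using b(3)[OF ya] .
  \<comment> \<open>On multiples of \<open>y\<close>, \<open>h\<close> acts as \<open>- a\<close> up
    to \<open>e\<close>: this is how \<open>y\<close> picks out the negative part of
    \<open>h\<close>.\<close>
  have hy: "h * y = - (a * y) + of_real e"
    by (simp add: y_def algebra_simps ha) (simp add: a(2) algebra_simps)
  have yh: "y * h = h * y" by (simp add: y_def algebra_simps ha)
  define k where "k = star (c * y) * (c * y)"
  have "k = y * h * y" by (simp add: k_def h_def star_mult sy mult.assoc)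
  also have "\<dots> = h * y * y" by (simp add: yh)
  finally have "k = h * y * y" .
  then have k: "k = - (a * y * y) + e *\<^sub>R y" by (simp add: hy algebra_simps of_real_def)
  have "(norm a)\<^sup>2 \<le> norm (h * h) + norm (of_real e :: 'a)"
    using norm_triangle_ineq[of "h * h" "of_real e"] norm_selfadjoint_square[OF sa] a(2) by simp
  also have "\<dots> \<le> (norm h + 1)\<^sup>2"
    using e norm_selfadjoint_square[OF sh] by (simp add: norm_of_real power2_eq_square algebra_simps add_increasing2)
  finally have "norm a \<le> norm h + 1" by (rule power2_le_imp_le) simp
  then have My: "norm y \<le> M" using norm_triangle_ineq4[of a h] by (simp add: y_def M_def)
  \<comment> \<open>\<open>g\<close> collects the terms of order \<open>e\<close>:
    \<open>b * b = a + e\<close> contributes \<open>e y * y\<close> and \<open>k\<close> contributes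
    \<open>e y\<close>. Hence the positive sum below is exactly
    \<open>of_real \<delta> - k\<close>.\<close>
  define g where "g = e *\<^sub>R (y * y + y)"
  define \<delta> where "\<delta> = e * (M\<^sup>2 + M)"
  have \<delta>: "\<delta> \<ge> 0" using e M by (simp add: \<delta>_def)
  have "norm (y * y + y) \<le> norm y * norm y + norm y"
    by (meson norm_triangle_le add_right_mono norm_mult_ineq)
  also have "\<dots> \<le> M\<^sup>2 + M" unfolding power2_eq_square using My M by (intro add_mono mult_mono) auto
  finally have "norm g \<le> \<delta>" using e by (simp add: g_def \<delta>_def)
  moreover have "star g = g" by (simp add: g_def star_scaleR star_add star_mult sy)
  ultimately have "kv_pos (of_real \<delta> - g)" by (intro kv_pos_of_real_diff)
  moreover have "kv_pos ((b * y) * (b * y))" using yb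
    by (intro kv_pos_square) (simp add: star_mult sb sy)
  ultimately have "kv_pos ((b * y) * (b * y) + (of_real \<delta> - g))" by (intro kv_pos_add)
  moreover have "(b * y) * (b * y) = (b * b) * y * y" by (metis mult.assoc yb)
  then have "(b * y) * (b * y) + (of_real \<delta> - g) = of_real \<delta> - k"
    by (simp add: b(2) k g_def algebra_simps of_real_def)
  ultimately have k\<delta>: "norm k \<le> 3 * \<delta>"
    unfolding k_def using \<delta> by (intro norm_le_if_kv_pos_diff_star_mult) auto
  have "y * y * y = a * y * y - h * y * y" by (simp add: y_def algebra_simps)
  also have "h * y * y = k" by (simp add: \<open>k = h * y * y\<close>)
  also have "a * y * y = e *\<^sub>R y - k" by (simp add: k)
  also have "e *\<^sub>R y - k - k = e *\<^sub>R y - 2 *\<^sub>R k" by (simp add: scaleR_2)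
  finally have "norm (y * y * y) \<le> norm (e *\<^sub>R y) + norm (2 *\<^sub>R k)"
    by (simp add: norm_triangle_ineq4 del: norm_scaleR)
  also have "\<dots> \<le> e * M + 2 * (3 * \<delta>)"
  proof (rule add_mono)
    show "norm (e *\<^sub>R y) \<le> e * M" using e My by simp
    show "norm (2 *\<^sub>R k) \<le> 2 * (3 * \<delta>)" using k\<delta> by simp
  qed
  also have "\<dots> = e * K" by (simp add: \<delta>_def K_def algebra_simps)
  finally have y3: "norm (y * y * y) \<le> \<eta> ^ 3" using e by simp
  \<comment> \<open>The norm of a self-adjoint power is known for exponents \<open>2 ^ m\<close>
    only, so the cube is reached through the fourth power.\<close>
  have "norm y ^ 3 \<le> norm (y * y * y)"
  proof (cases "y = 0")
    case False
    have "norm y ^ 4 = norm ((y * y) * (y * y))"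
      by (simp add: norm_selfadjoint_square sy star_mult flip: power_mult)
    also have "\<dots> \<le> norm (y * y * y) * norm y"
      using norm_mult_ineq[of "y * y * y" y] by (simp add: mult.assoc)
    finally show ?thesis using False by (simp add: power_numeral_reduce mult.commute)
  qed simp
  then have "norm y \<le> \<eta>" using y3 \<eta> by (metis power_mono_iff norm_ge_zero less_imp_le order_trans zero_less_numeral)
  then have "kv_pos (a + (of_real \<eta> - y))"
    using sy by (intro kv_pos_add a kv_pos_of_real_diff)
  then show "kv_pos (star c * c + of_real \<eta>)" by (simp add: y_def h_def algebra_simps)
qed

text \<open>If \<open>a * a = p + e\<close>, then \<open>star b * (p + e) * b\<close> has the form
  \<open>star c * c\<close> with \<open>c = a * b\<close>. The surplus \<open>e (star b * b)\<close>
  has norm at most \<open>\<eta>\<close>.\<close>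

lemma kv_pos_conjugate:
  assumes "kv_pos p" shows "kv_pos (star b * p * b)"
proof (rule kv_pos_closed)
  fix \<eta> :: real assume \<eta>: "\<eta> > 0"
  define e where "e = \<eta> / ((norm b)\<^sup>2 + 1)"
  have n: "(norm b)\<^sup>2 + 1 > 0" by (simp add: add_nonneg_pos)
  then have e: "e > 0" using \<eta> by (simp add: e_def)
  have "e * (norm b)\<^sup>2 \<le> e * ((norm b)\<^sup>2 + 1)" using e by simp
  then have eb: "e * (norm b)\<^sup>2 \<le> \<eta>" using n by (simp add: e_def)
  obtain a where a: "kv_pos a" "a * a = p + of_real e" using kv_pos_sqrt[OF assms e] by blast
  have "kv_pos (star (a * b) * (a * b))" by (rule kv_pos_star_mult)
  moreover have "star (a * b) * (a * b) = star b * (a * a) * b"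
    using kv_pos_selfadjoint[OF a(1)] by (simp add: star_mult mult.assoc)
  ultimately have "kv_pos (star b * (p + of_real e) * b)" by (simp add: a)
  moreover have "kv_pos (of_real \<eta> - e *\<^sub>R (star b * b))"
    using e eb by (intro kv_pos_of_real_diff) (auto simp: star_scaleR star_mult star_star cstar_identity)
  ultimately have "kv_pos (star b * (p + of_real e) * b + (of_real \<eta> - e *\<^sub>R (star b * b)))"
    by (rule kv_pos_add)
  then show "kv_pos (star b * p * b + of_real \<eta>)"
    by (simp add: algebra_simps of_real_def)
qed

section \<open>The unitization\<close>

text \<open>The unitization acts on the algebra by left multiplication. If the algebra has a unit already,
  this action is not faithful; taking the maximum with the modulus of the scalar part in the norm
  below covers this case as well.\<close>

definition unit_act :: "'a::cstar_algebra \<Rightarrow> complex \<Rightarrow> 'a \<Rightarrow> 'a" where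
  "unit_act a l z = a * z + l *\<^sub>C z"

definition unit_norm :: "'a::cstar_algebra \<Rightarrow> complex \<Rightarrow> real" where
  "unit_norm a l = max (cmod l) (onorm (unit_act a l))"

lemma scaleC_scaleR_commute: "c *\<^sub>C (r *\<^sub>R x) = r *\<^sub>R (c *\<^sub>C (x :: 'a::complex_vector))"
  by (simp add: scaleC_scaleC mult.commute flip: scaleC_of_real)

lemma bounded_linear_scaleC: "bounded_linear (\<lambda>x :: 'a::complex_normed_vector. c *\<^sub>C x)"
  by (rule bounded_linear_intro[where K = "cmod c"])
    (simp_all add: scaleC_add_right scaleC_scaleR_commute norm_scaleC)

lemma bounded_linear_unit_act: "bounded_linear (unit_act a l)"
  unfolding unit_act_def
  by (intro bounded_linear_add bounded_linear_mult_right bounded_linear_scaleC)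

lemma norm_unit_act_le: "norm (unit_act a l z) \<le> unit_norm a l * norm z"
proof -
  have "norm (unit_act a l z) \<le> onorm (unit_act a l) * norm z"
    by (rule onorm[OF bounded_linear_unit_act])
  also have "\<dots> \<le> unit_norm a l * norm z"
    by (intro mult_right_mono) (auto simp: unit_norm_def)
  finally show ?thesis .
qed

lemma unit_norm_le:
  assumes "cmod l \<le> b" "\<And>z. norm (unit_act a l z) \<le> b * norm z"
  shows "unit_norm a l \<le> b"
  using assms onorm_bound[of b "unit_act a l"] order_trans[OF norm_ge_zero assms(1)]
  by (simp add: unit_norm_def)

lemma cmod_le_unit_norm: "cmod l \<le> unit_norm a l"
  by (simp add: unit_norm_def)

lemma unit_norm_nonneg: "0 \<le> unit_norm a l"
  using cmod_le_unit_norm[of l a] norm_ge_zero order_trans by blast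

lemma unit_act_add: "unit_act (a + b) (l + m) z = unit_act a l z + unit_act b m z"
  by (simp add: unit_act_def algebra_simps scaleC_add_left)

lemma unit_act_scaleC: "unit_act (c *\<^sub>C a) (c * l) z = c *\<^sub>C unit_act a l z"
  by (simp add: unit_act_def scaleC_add_right scaleC_mult_left scaleC_scaleC)

lemma unit_act_mult:
  "unit_act (a * b + m *\<^sub>C a + l *\<^sub>C b) (l * m) z = unit_act a l (unit_act b m z)"
  by (simp add: unit_act_def algebra_simps scaleC_add_right scaleC_mult_left scaleC_mult_right scaleC_scaleC)

lemma unit_norm_add: "unit_norm (a + b) (l + m) \<le> unit_norm a l + unit_norm b m"
proof (rule unit_norm_le)
  show "cmod (l + m) \<le> unit_norm a l + unit_norm b m"
    by (intro norm_triangle_le add_mono cmod_le_unit_norm)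
  show "norm (unit_act (a + b) (l + m) z) \<le> (unit_norm a l + unit_norm b m) * norm z" for z
    unfolding unit_act_add distrib_right by (intro norm_triangle_le add_mono norm_unit_act_le)
qed

lemma unit_norm_scaleC: "unit_norm (c *\<^sub>C a) (c * l) = cmod c * unit_norm a l"
proof -
  have le: "unit_norm (c *\<^sub>C a) (c * l) \<le> cmod c * unit_norm a l" for c l and a :: 'a
    by (rule unit_norm_le)
      (simp_all add: unit_act_scaleC norm_scaleC norm_mult mult.assoc mult_left_mono
        cmod_le_unit_norm norm_unit_act_le)
  show ?thesis
  proof (cases "c = 0")
    case True
    then show ?thesis using le[of 0 a 0] unit_norm_nonneg[of "0::'a" 0]
      by (simp add: complex_vector.scale_zero_left)
  next
    case False
    then show ?thesis using le[of c a l] le[of "inverse c" "c *\<^sub>C a" "c * l"]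
      by (simp add: scaleC_scaleC scaleC_one norm_inverse norm_divide field_simps)
  qed
qed

lemma unit_norm_mult: "unit_norm (a * b + m *\<^sub>C a + l *\<^sub>C b) (l * m) \<le> unit_norm a l * unit_norm b m"
proof (rule unit_norm_le)
  show "cmod (l * m) \<le> unit_norm a l * unit_norm b m"
    unfolding norm_mult by (intro mult_mono cmod_le_unit_norm unit_norm_nonneg norm_ge_zero)
  show "norm (unit_act (a * b + m *\<^sub>C a + l *\<^sub>C b) (l * m) z) \<le> unit_norm a l * unit_norm b m * norm z" for z
    unfolding unit_act_mult mult.assoc
    by (rule order_trans[OF norm_unit_act_le]) (intro mult_left_mono norm_unit_act_le unit_norm_nonneg)
qed

text \<open>Evaluation at \<open>star a\<close> shows by the C*-identity that left multiplication by
  \<open>a\<close> has operator norm at least \<open>norm a\<close>.\<close>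

lemma unit_norm_zero_right: "unit_norm a 0 = norm a"
proof (rule antisym)
  show "unit_norm a 0 \<le> norm a"
    by (rule unit_norm_le) (simp_all add: unit_act_def complex_vector.scale_zero_left norm_mult_ineq)
  have "norm a * norm a = norm (unit_act a 0 (star a))"
    using cstar_identity[of "star a"]
    by (simp add: unit_act_def complex_vector.scale_zero_left star_star power2_eq_square)
  also have "\<dots> \<le> unit_norm a 0 * norm a" using norm_unit_act_le[of a 0 "star a"] by simp
  finally show "norm a \<le> unit_norm a 0"
    by (cases "a = 0") (auto simp: unit_norm_nonneg)
qed

lemma unit_norm_zero_left: "unit_norm 0 l = cmod l"
  by (intro antisym unit_norm_le cmod_le_unit_norm) (simp_all add: unit_act_def norm_scaleC)

lemma unit_norm_le_sum: "unit_norm a l \<le> norm a + cmod l"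
  using unit_norm_add[of a 0 0 l] by (simp add: unit_norm_zero_left unit_norm_zero_right)

text \<open>Subtracting the scalar part costs at most another \<open>unit_norm a l\<close>. Together
  with \<open>unit_norm_le_sum\<close> this makes the norm equivalent to the sum norm, whence
  completeness.\<close>

lemma norm_le_unit_norm: "norm a \<le> 2 * unit_norm a l"
  using unit_norm_add[of a 0 l "- l"] cmod_le_unit_norm[of l a]
  by (simp add: unit_norm_zero_left unit_norm_zero_right)

text \<open>The arguments on the right are the two parts of \<open>star x * x\<close> for the pair
  \<open>x = (a, l)\<close>. The C*-identity of the algebra, applied to
  \<open>unit_act a l z\<close>, bounds the operator norm.\<close>

lemma unit_norm_cstar_le:
  "(unit_norm a l)\<^sup>2 \<le> unit_norm (star a * a + l *\<^sub>C star a + cnj l *\<^sub>C a) (cnj l * l)"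
    (is "_ \<le> ?N")
proof -
  have "unit_norm a l \<le> sqrt ?N"
  proof (rule unit_norm_le)
    have "(cmod l)\<^sup>2 \<le> ?N"
      using cmod_le_unit_norm[of "cnj l * l"] by (simp add: norm_mult power2_eq_square)
    then show "cmod l \<le> sqrt ?N" by (simp add: real_le_rsqrt)
  next
    fix z
    have "star (unit_act a l z) * unit_act a l z = star z * unit_act (star a) (cnj l) (unit_act a l z)"
      by (simp add: unit_act_def star_add star_mult star_scaleC algebra_simps scaleC_mult_left
          scaleC_mult_right scaleC_add_right scaleC_scaleC)
    then have "(norm (unit_act a l z))\<^sup>2
        \<le> norm (star z) * norm (unit_act (star a) (cnj l) (unit_act a l z))"
      by (metis cstar_identity norm_mult_ineq)
    also have "\<dots> \<le> norm z * (?N * norm z)"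
      unfolding unit_act_mult[symmetric] norm_star by (intro mult_left_mono norm_unit_act_le norm_ge_zero)
    also have "\<dots> = (sqrt ?N * norm z)\<^sup>2"
      by (simp add: power_mult_distrib unit_norm_nonneg power2_eq_square[of "norm z"])
    finally show "norm (unit_act a l z) \<le> sqrt ?N * norm z"
      by (rule power2_le_imp_le) (simp add: unit_norm_nonneg)
  qed
  then have "(unit_norm a l)\<^sup>2 \<le> (sqrt ?N)\<^sup>2" by (intro power_mono unit_norm_nonneg)
  then show ?thesis by (simp add: unit_norm_nonneg)
qed

lemma unit_norm_star: "unit_norm (star a) (cnj l) = unit_norm a l"
proof -
  have le: "unit_norm b m \<le> unit_norm (star b) (cnj m)" for b :: 'a and m
  proof -
    have "(unit_norm b m)\<^sup>2 \<le> unit_norm (star b) (cnj m) * unit_norm b m"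
      by (rule order_trans[OF unit_norm_cstar_le unit_norm_mult])
    then show ?thesis
      using unit_norm_nonneg[of b m] unit_norm_nonneg[of "star b" "cnj m"]
      by (cases "unit_norm b m = 0") (auto simp: power2_eq_square)
  qed
  show ?thesis using le[of a l] le[of "star a" "cnj l"] by (simp add: star_star)
qed

lemma unit_norm_cstar:
  "unit_norm (star a * a + l *\<^sub>C star a + cnj l *\<^sub>C a) (cnj l * l) = (unit_norm a l)\<^sup>2"
  using unit_norm_cstar_le[of a l] unit_norm_mult[of "star a" a l "cnj l"]
  by (simp add: unit_norm_star power2_eq_square)

section \<open>The unitization as a unital C*-algebra\<close>

datatype 'a unitization = Unitization (vec_part: 'a) (scal_part: complex)

instantiation unitization :: (cstar_algebra) complex_vector
begin

definition "0 = Unitization 0 0"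
definition "x + y = Unitization (vec_part x + vec_part y) (scal_part x + scal_part y)"
definition "x - y = Unitization (vec_part x - vec_part y) (scal_part x - scal_part y)"
definition "- x = Unitization (- vec_part x) (- scal_part x)"
definition "r *\<^sub>R x = Unitization (r *\<^sub>R vec_part x) (r *\<^sub>R scal_part x)"
definition "c *\<^sub>C x = Unitization (c *\<^sub>C vec_part x) (c * scal_part x)"

lemmas unitization_vector_defs = zero_unitization_def plus_unitization_def minus_unitization_def
  uminus_unitization_def scaleR_unitization_def scaleC_unitization_def

instance
  by standard
    (simp_all add: unitization_vector_defs unitization.expand algebra_simps
      scaleC_add_right scaleC_add_left scaleC_scaleC scaleC_of_real complex_eq_iff)

end

instantiation unitization :: (cstar_algebra) complex_normed_vector
begin

definition "norm x = unit_norm (vec_part x) (scal_part x)"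
definition "dist x y = norm (x - y :: 'a unitization)"
definition "sgn x = inverse (norm x) *\<^sub>R (x :: 'a unitization)"
definition "uniformity = (INF e\<in>{0<..}. principal {(x, y :: 'a unitization). dist x y < e})"
definition "open U \<longleftrightarrow> (\<forall>x\<in>U. \<forall>\<^sub>F (x', y) in uniformity. x' = x \<longrightarrow> (y :: 'a unitization) \<in> U)"

instance
proof
  fix x y :: "'a unitization" and r :: real and c :: complex and U :: "'a unitization set"
  show "dist x y = norm (x - y)" by (rule dist_unitization_def)
  show "sgn x = inverse (norm x) *\<^sub>R x" by (rule sgn_unitization_def)
  show "uniformity = (INF e\<in>{0<..}. principal {(x, y :: 'a unitization). dist x y < e})"
    by (rule uniformity_unitization_def)
  show "open U \<longleftrightarrow> (\<forall>x\<in>U. \<forall>\<^sub>F (x', y) in uniformity. x' = x \<longrightarrow> y \<in> U)"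
    by (rule open_unitization_def)
  show "norm x = 0 \<longleftrightarrow> x = 0"
  proof
    assume "norm x = 0"
    then have "unit_norm (vec_part x) (scal_part x) = 0" by (simp add: norm_unitization_def)
    then have "scal_part x = 0" "vec_part x = 0"
      using cmod_le_unit_norm[of "scal_part x" "vec_part x"]
        norm_le_unit_norm[of "vec_part x" "scal_part x"] by auto
    then show "x = 0" by (simp add: zero_unitization_def unitization.expand)
  qed (simp add: norm_unitization_def zero_unitization_def unit_norm_zero_right)
  show "norm (x + y) \<le> norm x + norm y"
    by (simp add: norm_unitization_def plus_unitization_def unit_norm_add)
  show norm_scaleC: "norm (c *\<^sub>C x) = cmod c * norm x" for c
    by (simp add: norm_unitization_def scaleC_unitization_def unit_norm_scaleC)
  show "norm (r *\<^sub>R x) = \<bar>r\<bar> * norm x"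
    using norm_scaleC[of "complex_of_real r"] by (simp add: scaleC_of_real)
qed

end

instance unitization :: (cstar_algebra) complex_banach
proof
  fix X :: "nat \<Rightarrow> 'a unitization"
  assume X: "Cauchy X"
  have le: "norm (vec_part x) \<le> 2 * norm x" "cmod (scal_part x) \<le> 2 * norm x" for x :: "'a unitization"
    using norm_le_unit_norm[of "vec_part x" "scal_part x"] cmod_le_unit_norm[of "scal_part x" "vec_part x"]
      unit_norm_nonneg[of "vec_part x" "scal_part x"]
    unfolding norm_unitization_def by linarith+
  have "bounded_linear (vec_part :: 'a unitization \<Rightarrow> 'a)" "bounded_linear (scal_part :: 'a unitization \<Rightarrow> complex)"
    by (rule bounded_linear_intro[where K = 2];
        use le in \<open>simp add: plus_unitization_def scaleR_unitization_def mult.commute\<close>)+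
  then have "Cauchy (\<lambda>n. vec_part (X n))" "Cauchy (\<lambda>n. scal_part (X n))"
    using X by (simp_all add: bounded_linear.Cauchy)
  then obtain a l where al: "(\<lambda>n. vec_part (X n)) \<longlonglongrightarrow> a" "(\<lambda>n. scal_part (X n)) \<longlonglongrightarrow> l"
    by (meson Cauchy_convergent convergent_def)
  have "(\<lambda>n. norm (vec_part (X n) - a) + cmod (scal_part (X n) - l)) \<longlonglongrightarrow> 0 + 0"
    using al by (intro tendsto_add tendsto_norm_zero LIM_zero)
  then have lim: "(\<lambda>n. norm (vec_part (X n) - a) + cmod (scal_part (X n) - l)) \<longlonglongrightarrow> 0" by simp
  have "norm (X n - Unitization a l) \<le> norm (vec_part (X n) - a) + cmod (scal_part (X n) - l)" for n
    by (simp add: norm_unitization_def minus_unitization_def unit_norm_le_sum)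
  then have "(\<lambda>n. X n - Unitization a l) \<longlonglongrightarrow> 0"
    by (intro Lim_null_comparison[OF always_eventually lim] allI)
  then have "X \<longlonglongrightarrow> Unitization a l" by (rule LIM_zero_cancel)
  then show "convergent X" by (rule convergentI)
qed

instantiation unitization :: (cstar_algebra) unital_cstar_algebra
begin

definition "1 = Unitization 0 1"
definition "x * y = Unitization
  (vec_part x * vec_part y + scal_part y *\<^sub>C vec_part x + scal_part x *\<^sub>C vec_part y)
  (scal_part x * scal_part y)"
definition "star x = Unitization (star (vec_part x)) (cnj (scal_part x))"

lemmas unitization_algebra_defs = unitization_vector_defs
  one_unitization_def times_unitization_def star_unitization_def

instance
proof
  fix x y z :: "'a unitization" and r :: real and c :: complex
  show "norm (x * y) \<le> norm x * norm y"
    by (simp add: norm_unitization_def times_unitization_def unit_norm_mult)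
  show "norm (1 :: 'a unitization) = 1"
    by (simp add: norm_unitization_def one_unitization_def unit_norm_zero_left)
  show "norm (star x * x) = (norm x)\<^sup>2"
    using unit_norm_cstar[of "vec_part x" "scal_part x"]
    by (simp add: norm_unitization_def times_unitization_def star_unitization_def)
qed (simp_all add: unitization_algebra_defs unitization.expand algebra_simps star_add star_mult
    star_scaleC star_star scaleC_add_right scaleC_add_left scaleC_scaleC scaleC_mult_left
    scaleC_mult_right scaleC_scaleR_commute complex_vector.scale_zero_left scaleC_one scaleR_conv_of_real[where 'a = complex]
    flip: scaleC_of_real)

end

section \<open>Positivity in an arbitrary C*-algebra\<close>

definition unit_embed :: "'a::cstar_algebra \<Rightarrow> 'a unitization" where
  "unit_embed a = Unitization a 0"

lemma unit_embed_add: "unit_embed (a + b) = unit_embed a + unit_embed b"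
  and unit_embed_diff: "unit_embed (a - b) = unit_embed a - unit_embed b"
  and unit_embed_mult: "unit_embed (a * b) = unit_embed a * unit_embed b"
  and unit_embed_star: "unit_embed (star a) = star (unit_embed a)"
  and unit_embed_scaleR: "unit_embed (r *\<^sub>R a) = r *\<^sub>R unit_embed a"
  and norm_unit_embed: "norm (unit_embed a) = norm a"
  by (simp_all add: unit_embed_def unitization_algebra_defs norm_unitization_def unit_norm_zero_right
      complex_vector.scale_zero_left)

definition nonneg :: "'a::cstar_algebra \<Rightarrow> bool" where
  "nonneg a \<longleftrightarrow> kv_pos (unit_embed a)"

lemma nonneg_star_mult: "nonneg (star b * b)"
  by (simp add: nonneg_def unit_embed_mult unit_embed_star kv_pos_star_mult)

lemma nonneg_if_cstar_pos: "cstar_pos a \<Longrightarrow> nonneg a"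
  using nonneg_star_mult by (auto simp: cstar_pos_def)

lemma nonneg_add: "nonneg a \<Longrightarrow> nonneg b \<Longrightarrow> nonneg (a + b)"
  by (simp add: nonneg_def unit_embed_add kv_pos_add)

lemma nonneg_zero: "nonneg 0"
  using nonneg_star_mult[of 0] by simp

lemma nonneg_scaleR:
  assumes "nonneg a" "0 \<le> r" shows "nonneg (r *\<^sub>R a)"
proof -
  have "kv_pos (star (of_real (sqrt r)) * unit_embed a * of_real (sqrt r))"
    using assms by (intro kv_pos_conjugate) (simp add: nonneg_def)
  then show ?thesis using assms
    by (simp only: star_of_real) (simp add: nonneg_def unit_embed_scaleR of_real_def)
qed

lemma nonneg_sum: "(\<And>i. i \<in> I \<Longrightarrow> nonneg (f i)) \<Longrightarrow> nonneg (sum f I)"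
  by (induction I rule: infinite_finite_induct) (simp_all add: nonneg_zero nonneg_add)

lemma norm_le_if_nonneg_diff:
  assumes "nonneg a" "nonneg (b - a)" shows "norm a \<le> norm b"
  using norm_le_norm_add[of "unit_embed a" "unit_embed (b - a)"] assms
  by (simp add: nonneg_def norm_unit_embed flip: unit_embed_add)

text \<open>In the unitization \<open>h\<close> is at most the scalar \<open>r\<close>; conjugation
  by \<open>b\<close> leads back into the algebra.\<close>

lemma nonneg_scaleR_diff_conjugate:
  assumes "nonneg h" "norm h \<le> r"
  shows "nonneg (r *\<^sub>R (star b * b) - star b * h * b)"
proof -
  have "kv_pos (star (unit_embed b) * (of_real r - unit_embed h) * unit_embed b)"
    using assms
    by (intro kv_pos_conjugate kv_pos_of_real_diff) (simp_all add: nonneg_def kv_pos_selfadjoint norm_unit_embed)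
  then show ?thesis
    by (simp add: nonneg_def unit_embed_diff unit_embed_mult unit_embed_star unit_embed_scaleR
        of_real_def algebra_simps)
qed

section \<open>Rank one maps and their Cesaro means\<close>

context hilbert_module
begin

lemma act_scaleR_left: "act (r *\<^sub>R x) a = r *\<^sub>R act x a"
  using act_scaleC_left[of "complex_of_real r"] by (simp add: scaleC_of_real)

lemma act_sum_left: "act (\<Sum>i\<in>I. f i) a = (\<Sum>i\<in>I. act (f i) a)"
proof -
  have "linear (\<lambda>x. act x a)" by (rule linearI) (simp_all add: act_add_left act_scaleR_left)
  then show ?thesis by (rule linear_sum)
qed

lemma act_diff_left: "act (x - y) a = act x a - act y a"
  using act_add_left[of "x - y" y a] by simp

lemma act_scaleR_right: "act x (r *\<^sub>R a) = r *\<^sub>R act x a"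
  using act_scaleC_right[of x "complex_of_real r"] by (simp add: scaleC_of_real)

lemma ip_scaleR_right: "ip x (r *\<^sub>R y) = r *\<^sub>R ip x y"
  using ip_scaleC_right[of x "complex_of_real r"] by (simp add: scaleC_of_real)

lemma linear_ip_right: "linear (ip x)"
  by (rule linearI) (simp_all add: ip_add_right ip_scaleR_right)

lemma linear_ip_left: "linear (\<lambda>x. ip x y)"
  unfolding ip_star[of _ y]
  by (rule linearI) (simp_all add: ip_add_right ip_scaleR_right star_add star_scaleR)

lemmas ip_diff_right = linear_diff[OF linear_ip_right]
  and ip_diff_left = linear_diff[OF linear_ip_left]
  and ip_sum_right = linear_sum[OF linear_ip_right]
  and ip_sum_left = linear_sum[OF linear_ip_left]
  and ip_scaleR_left = linear_scale[OF linear_ip_left]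

lemma ip_act_left: "ip (act x a) y = star a * ip x y"
  by (metis ip_star ip_act_right star_mult)

lemma norm_ip_self: "norm (ip x x) = (norm x)\<^sup>2"
  using norm_ip[of x] by simp

lemma nonneg_ip_self: "nonneg (ip x x)"
  by (rule nonneg_if_cstar_pos[OF ip_pos])

lemma norm_act_le: "norm (act x a) \<le> norm x * norm a"
proof -
  have "(norm (act x a))\<^sup>2 = norm (star a * ip x x * a)"
    by (simp add: norm_ip_self[symmetric] ip_act_left ip_act_right mult.assoc)
  also have "\<dots> \<le> norm (star a) * norm (ip x x) * norm a"
    by (meson norm_mult_ineq order_trans mult_right_mono norm_ge_zero)
  also have "\<dots> = (norm x * norm a)\<^sup>2" by (simp add: norm_ip_self power2_eq_square)
  finally show ?thesis by (rule power2_le_imp_le) simp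
qed

text \<open>Cauchy-Schwarz: positivity of \<open>ip v v\<close>, with
  \<open>star a * ip x x * a\<close> bounded above by \<open>r (star a * a)\<close>, yields
  \<open>r (star a * a) \<le> (r * r) (ip y y)\<close> in the order of the algebra.\<close>

lemma norm_ip_le: "norm (ip x y) \<le> norm x * norm y"
proof (cases "x = 0")
  case True
  then show ?thesis using linear_0[OF linear_ip_left] by simp
next
  case False
  define a where "a = ip x y"
  define r where "r = (norm x)\<^sup>2"
  have r: "r > 0" using False by (simp add: r_def)
  define v where "v = r *\<^sub>R y - act x a"
  have yx: "ip y x = star a" by (simp add: a_def ip_star[symmetric])
  have vv: "ip v v = (r * r) *\<^sub>R ip y y - (2 * r) *\<^sub>R (star a * a) + star a * ip x x * a"
    by (simp add: v_def ip_diff_left ip_diff_right ip_scaleR_left ip_scaleR_right ip_act_left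
        ip_act_right yx flip: a_def) (simp add: algebra_simps scaleR_2 flip: scaleR_scaleR)
  have "nonneg (ip v v + (r *\<^sub>R (star a * a) - star a * ip x x * a))"
    by (intro nonneg_add nonneg_ip_self nonneg_scaleR_diff_conjugate) (simp add: r_def norm_ip_self)
  also have "ip v v + (r *\<^sub>R (star a * a) - star a * ip x x * a)
      = (r * r) *\<^sub>R ip y y - r *\<^sub>R (star a * a)"
    unfolding vv by (simp add: algebra_simps scaleR_2 flip: scaleR_scaleR)
  finally have "norm (r *\<^sub>R (star a * a)) \<le> norm ((r * r) *\<^sub>R ip y y)"
    using r by (intro norm_le_if_nonneg_diff nonneg_scaleR nonneg_star_mult) auto
  then have "r * (norm a)\<^sup>2 \<le> r * (r * (norm y)\<^sup>2)"
    using r by (simp add: cstar_identity norm_ip_self abs_mult)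
  then have "(norm a)\<^sup>2 \<le> r * (norm y)\<^sup>2" using r by (simp only: mult_le_cancel_left_pos)
  then have "(norm a)\<^sup>2 \<le> (norm x * norm y)\<^sup>2" by (simp add: r_def power_mult_distrib)
  then show ?thesis unfolding a_def by (rule power2_le_imp_le) simp
qed

text \<open>The difference \<open>ip z z - ip ?v ?v\<close> is the sum of \<open>star b * b\<close>
  and \<open>star b * (1 - ip x x) * b\<close>, both positive because
  \<open>norm (ip x x) \<le> 1\<close>.\<close>

lemma norm_diff_rank_one_le:
  assumes "norm x \<le> 1"
  shows "norm (z - act x (ip x z)) \<le> norm z"
proof -
  define b where "b = ip x z"
  let ?v = "z - act x b"
  have zx: "ip z x = star b" by (simp add: b_def ip_star[symmetric])
  have vv: "ip ?v ?v = ip z z - star b * b - (star b * b - star b * ip x x * b)"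
    by (simp add: ip_diff_left ip_diff_right ip_act_left ip_act_right zx flip: b_def)
      (simp add: algebra_simps)
  have "norm (ip x x) \<le> 1" using assms by (simp add: norm_ip_self power_le_one)
  then have "nonneg (star b * b - star b * ip x x * b)"
    using nonneg_scaleR_diff_conjugate[OF nonneg_ip_self, of x 1 b] by simp
  then have "nonneg (star b * b + (star b * b - star b * ip x x * b))"
    by (intro nonneg_add nonneg_star_mult)
  also have "star b * b + (star b * b - star b * ip x x * b) = ip z z - ip ?v ?v"
    unfolding vv by (simp add: algebra_simps)
  finally have "norm (ip ?v ?v) \<le> norm (ip z z)"
    by (intro norm_le_if_nonneg_diff nonneg_ip_self)
  then show ?thesis unfolding norm_ip_self b_def by (rule power2_le_imp_le) simp
qed

end

section \<open>Operations on bounded module maps\<close>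

lemma bounded_module_mapD:
  assumes "bounded_module_map act act' f"
  shows "bounded_linear f" "linear f" "f (c *\<^sub>C x) = c *\<^sub>C f x" "f (act x a) = act' (f x) a"
  using assms by (auto simp: bounded_module_map_def bounded_linear.linear)

lemma bounded_module_map_id: "bounded_module_map act act (\<lambda>x. x)"
  by (simp add: bounded_module_map_def bounded_linear_ident)

lemma bounded_module_map_compose:
  "bounded_module_map act1 act2 g \<Longrightarrow> bounded_module_map act act1 f \<Longrightarrow>
    bounded_module_map act act2 (\<lambda>x. g (f x))"
  by (simp add: bounded_module_map_def bounded_linear_compose)

lemma bounded_module_map_funpow:
  "bounded_module_map act act f \<Longrightarrow> bounded_module_map act act (f ^^ n)"
  by (induction n) (simp_all add: id_def bounded_module_map_id comp_def bounded_module_map_compose)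

lemma scaleC_sum_right: "c *\<^sub>C (\<Sum>i\<in>I. f i) = (\<Sum>i\<in>I. c *\<^sub>C (f i :: 'a::complex_normed_vector))"
  by (rule linear_sum[OF bounded_linear.linear[OF bounded_linear_scaleC]])

context hilbert_module
begin

lemma bounded_module_map_sum:
  "(\<And>i. i \<in> I \<Longrightarrow> bounded_module_map act0 act (f i)) \<Longrightarrow>
    bounded_module_map act0 act (\<lambda>x. \<Sum>i\<in>I. f i x)"
  by (simp add: bounded_module_map_def bounded_linear_sum scaleC_sum_right act_sum_left)

lemma bounded_module_map_diff:
  "bounded_module_map act0 act f \<Longrightarrow> bounded_module_map act0 act g \<Longrightarrow>
    bounded_module_map act0 act (\<lambda>x. f x - g x)"
  by (simp add: bounded_module_map_def bounded_linear_sub complex_vector.scale_right_diff_distrib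
      act_diff_left)

lemma bounded_module_map_scaleR:
  "bounded_module_map act0 act f \<Longrightarrow> bounded_module_map act0 act (\<lambda>x. r *\<^sub>R f x)"
  by (simp add: bounded_module_map_def bounded_linear_const_scaleR scaleC_scaleR_commute
      act_scaleR_left)

end

lemma bounded_module_map_rank_one:
  assumes "hilbert_module act ip" "hilbert_module act' ip'"
  shows "bounded_module_map act act' (\<lambda>z. act' w (ip x z))"
proof -
  interpret H: hilbert_module act ip by fact
  interpret H': hilbert_module act' ip' by fact
  have "bounded_linear (\<lambda>z. act' w (ip x z))"
  proof (rule bounded_linear_intro)
    show "norm (act' w (ip x z)) \<le> norm z * (norm w * norm x)" for z
      using order_trans[OF H'.norm_act_le mult_left_mono[OF H.norm_ip_le norm_ge_zero]]
      by (simp add: ac_simps)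
  qed (simp_all add: H.ip_add_right H'.act_add_right H.ip_scaleR_right H'.act_scaleR_right)
  then show ?thesis
    by (simp add: bounded_module_map_def H.ip_scaleC_right H'.act_scaleC_right H.ip_act_right H'.act_mult)
qed

section \<open>Cesaro means of the powers of a contraction\<close>

definition cesaro_mean :: "('a::real_vector \<Rightarrow> 'a) \<Rightarrow> nat \<Rightarrow> 'a \<Rightarrow> 'a" where
  "cesaro_mean f m x = (1 / real m) *\<^sub>R (\<Sum>j<m. (f ^^ j) x)"

lemma norm_funpow_le:
  fixes f :: "'a::real_normed_vector \<Rightarrow> 'a"
  assumes "\<And>x. norm (f x) \<le> norm x" shows "norm ((f ^^ n) x) \<le> norm x"
proof (induction n)
  case (Suc n)
  then show ?case using assms[of "(f ^^ n) x"] by simp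
qed simp

lemma norm_cesaro_mean_le:
  fixes f :: "'a::real_normed_vector \<Rightarrow> 'a"
  assumes "\<And>x. norm (f x) \<le> norm x" shows "norm (cesaro_mean f m x) \<le> norm x"
proof -
  have "norm (\<Sum>j<m. (f ^^ j) x) \<le> real m * norm x"
    using sum_norm_bound[of "{..<m}" "\<lambda>j. (f ^^ j) x" "norm x"] norm_funpow_le[OF assms] by simp
  then show ?thesis by (cases "m = 0") (simp_all add: cesaro_mean_def field_simps)
qed

text \<open>The sum telescopes to \<open>x - (f ^^ m) x\<close>, of norm at most
  \<open>2 * norm x\<close>.\<close>

lemma norm_cesaro_mean_diff_le:
  fixes f :: "'a::real_normed_vector \<Rightarrow> 'a"
  assumes "linear f" "\<And>x. norm (f x) \<le> norm x"
  shows "norm (cesaro_mean f m x - f (cesaro_mean f m x)) \<le> 2 / real m * norm x"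
proof -
  have "cesaro_mean f m x - f (cesaro_mean f m x)
      = (1 / real m) *\<^sub>R (\<Sum>j<m. (f ^^ j) x - (f ^^ Suc j) x)"
    by (simp add: cesaro_mean_def linear_scale[OF assms(1)] linear_sum[OF assms(1)]
        scaleR_diff_right sum_subtractf)
  also have "\<dots> = (1 / real m) *\<^sub>R (x - (f ^^ m) x)"
    by (subst sum_lessThan_telescope') simp
  also have "norm \<dots> \<le> (1 / real m) * (norm x + norm x)"
    unfolding norm_scaleR using norm_funpow_le[OF assms(2), of m x]
    by (intro mult_mono) (auto intro: order_trans[OF norm_triangle_ineq4])
  finally show ?thesis by simp
qed

context hilbert_module
begin

text \<open>This is \<open>C\<^sub>n\<close>, written as an average of contractions so that its norm
  bound follows by convexity.\<close>

definition avg_compl :: "(nat \<Rightarrow> 'h) \<Rightarrow> nat \<Rightarrow> 'h \<Rightarrow> 'h" where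
  "avg_compl x n z = (1 / real (Suc n)) *\<^sub>R (\<Sum>i\<le>n. z - act (x i) (ip (x i) z))"

lemma bounded_module_map_avg_compl: "bounded_module_map act act (avg_compl x n)"
  unfolding avg_compl_def
  by (intro bounded_module_map_scaleR bounded_module_map_sum bounded_module_map_diff
      bounded_module_map_id bounded_module_map_rank_one[where ip' = ip] hilbert_module_axioms)

lemma diff_avg_compl:
  "z - avg_compl x n z = (1 / real (Suc n)) *\<^sub>R (\<Sum>i\<le>n. act (x i) (ip (x i) z))"
  by (simp add: avg_compl_def sum_subtractf scaleR_diff_right sum_constant_scaleR del: of_nat_Suc)

lemma norm_avg_compl_le:
  assumes "\<And>i. norm (x i) \<le> 1" shows "norm (avg_compl x n z) \<le> norm z"
proof -
  have "norm (\<Sum>i\<le>n. z - act (x i) (ip (x i) z)) \<le> real (Suc n) * norm z"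
    using sum_norm_bound[of "{..n}" "\<lambda>i. z - act (x i) (ip (x i) z)" "norm z"]
      norm_diff_rank_one_le[OF assms] by simp
  then show ?thesis by (simp add: avg_compl_def divide_simps mult.commute del: of_nat_Suc)
qed

lemma ip_avg_compl: "ip (avg_compl x n y) z = ip y (avg_compl x n z)"
proof -
  have "ip (act u (ip u y)) z = ip y (act u (ip u z))" for u
    by (simp add: ip_act_left ip_act_right ip_star[symmetric])
  then show ?thesis
    by (simp add: avg_compl_def ip_scaleR_left ip_scaleR_right ip_sum_left ip_sum_right
        ip_diff_left ip_diff_right)
qed

lemma ip_cesaro_mean:
  assumes "\<And>y z. ip (f y) z = ip y (f z)"
  shows "ip (cesaro_mean f m y) z = ip y (cesaro_mean f m z)"
proof -
  have "ip ((f ^^ j) y) z = ip y ((f ^^ j) z)" for j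
    by (induction j arbitrary: z) (simp_all add: assms funpow_swap1[symmetric])
  then show ?thesis
    by (simp add: cesaro_mean_def ip_scaleR_left ip_scaleR_right ip_sum_left ip_sum_right)
qed

text \<open>Up to the factor \<open>Suc n\<close>, \<open>ip w (w - avg_compl x n w)\<close> is a
  sum of positive elements, so its norm controls each summand. Cauchy-Schwarz bounds it from
  above.\<close>

lemma norm_ip_le_diff_avg_compl:
  assumes "i \<le> n"
  shows "(norm (ip (x i) w))\<^sup>2 \<le> real (Suc n) * (norm w * norm (w - avg_compl x n w))"
proof -
  have "ip w (w - avg_compl x n w)
      = (1 / real (Suc n)) *\<^sub>R (\<Sum>j\<le>n. star (ip (x j) w) * ip (x j) w)"
    by (simp only: diff_avg_compl ip_scaleR_right ip_sum_right ip_act_right ip_star[of w, symmetric])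
  then have sum: "(\<Sum>j\<le>n. star (ip (x j) w) * ip (x j) w) = real (Suc n) *\<^sub>R ip w (w - avg_compl x n w)"
    by (simp del: of_nat_Suc)
  have "norm (star (ip (x i) w) * ip (x i) w) \<le> norm (\<Sum>j\<le>n. star (ip (x j) w) * ip (x j) w)"
  proof (rule norm_le_if_nonneg_diff[OF nonneg_star_mult])
    show "nonneg ((\<Sum>j\<le>n. star (ip (x j) w) * ip (x j) w) - star (ip (x i) w) * ip (x i) w)"
      using assms by (subst sum.remove[of _ i]) (auto intro: nonneg_sum nonneg_star_mult)
  qed
  also have "\<dots> \<le> real (Suc n) * (norm w * norm (w - avg_compl x n w))"
    unfolding sum by (simp add: norm_ip_le del: of_nat_Suc)
  finally show ?thesis by (simp add: cstar_identity)
qed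

text \<open>The mean is self-adjoint, so \<open>ip y y = ip (x i) w\<close>. The preceding lemma and
  the telescoping bound for \<open>w\<close> give an estimate of \<open>norm y ^ 4\<close> by a
  multiple of \<open>(norm y)\<^sup>2\<close>, which is divided out.\<close>

lemma norm_cesaro_mean_avg_compl_le:
  assumes x: "\<And>i. norm (x i) \<le> 1" and "i \<le> n"
  shows "(norm (cesaro_mean (avg_compl x n) m (x i)))\<^sup>2 \<le> 2 * real (Suc n) / real m"
proof -
  let ?C = "avg_compl x n"
  define y where "y = cesaro_mean ?C m (x i)"
  define w where "w = cesaro_mean ?C m y"
  note C = norm_avg_compl_le[of x n, OF x]
  have "((norm y)\<^sup>2)\<^sup>2 = (norm (ip (x i) w))\<^sup>2"
    unfolding norm_ip_self[symmetric] w_def by (subst (1) y_def) (simp add: ip_cesaro_mean ip_avg_compl)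
  also have "\<dots> \<le> real (Suc n) * (norm w * norm (w - ?C w))"
    using assms by (intro norm_ip_le_diff_avg_compl)
  also have "\<dots> \<le> real (Suc n) * (norm y * (2 / real m * norm y))"
    unfolding w_def using bounded_module_mapD(2)[OF bounded_module_map_avg_compl, of x n]
    by (intro mult_left_mono mult_mono norm_cesaro_mean_le norm_cesaro_mean_diff_le C) auto
  finally have le: "(norm y)\<^sup>2 * (norm y)\<^sup>2 \<le> (2 * real (Suc n) / real m) * (norm y)\<^sup>2"
    by (simp add: power2_eq_square mult_ac del: of_nat_Suc)
  have "(norm y)\<^sup>2 \<le> 2 * real (Suc n) / real m" if "y \<noteq> 0"
    by (rule mult_right_le_imp_le[OF le]) (use that in simp)
  then show ?thesis unfolding y_def[symmetric] by (cases "y = 0") auto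
qed

end

section \<open>Strong convergence to zero, tested on generators\<close>

lemma closed_contractions_tendsto_zero:
  fixes f :: "nat \<Rightarrow> 'a::real_normed_vector \<Rightarrow> 'b::real_normed_vector"
  assumes "\<And>n. linear (f n)" "\<And>n x. norm (f n x) \<le> norm x"
  shows "closed {x. (\<lambda>n. f n x) \<longlonglongrightarrow> 0}" (is "closed ?D")
proof -
  have "x \<in> ?D" if x: "x \<in> closure ?D" for x
  proof -
    have "(\<lambda>n. f n x) \<longlonglongrightarrow> 0"
    proof (rule LIMSEQ_I)
      fix r :: real assume "r > 0"
      then obtain y where y: "(\<lambda>n. f n y) \<longlonglongrightarrow> 0" "norm (x - y) < r / 2"
        using x by (force simp: closure_approachable dist_norm norm_minus_commute dest!: spec[of _ "r / 2"])
      obtain N where N: "\<And>n. n \<ge> N \<Longrightarrow> norm (f n y) < r / 2"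
        using LIMSEQ_D[OF y(1), of "r / 2"] \<open>r > 0\<close> by auto
      have "norm (f n x) < r" if "n \<ge> N" for n
      proof -
        have "f n x = f n (x - y) + f n y" by (simp add: linear_diff[OF assms(1)])
        then have "norm (f n x) \<le> norm (f n (x - y)) + norm (f n y)"
          by (metis norm_triangle_ineq)
        then show ?thesis using N[OF that] y(2) assms(2)[of n "x - y"] by linarith
      qed
      then show "\<exists>N. \<forall>n\<ge>N. norm (f n x - 0) < r" by auto
    qed
    then show ?thesis by simp
  qed
  then show ?thesis by (meson closure_subset_eq subsetI)
qed

text \<open>The vectors sent to zero in the limit form a subspace, closed by the uniform norm bound.
  Module linearity puts every \<open>act z a\<close> with \<open>z \<in> F\<close> into it.\<close>

lemma countably_generated_contractions_tendsto_zero: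
  assumes H: "hilbert_module act ip"
    and gen: "closure (cspan {act z a |z a. z \<in> F}) = UNIV"
    and f: "\<And>n. bounded_module_map act act (f n)"
    and le: "\<And>n x. norm (f n x) \<le> norm x"
    and lim: "\<And>z. z \<in> F \<Longrightarrow> (\<lambda>n. f n z) \<longlonglongrightarrow> 0"
  shows "(\<lambda>n. f n x) \<longlonglongrightarrow> 0"
proof -
  interpret hilbert_module act ip by fact
  let ?D = "{x. (\<lambda>n. f n x) \<longlonglongrightarrow> 0}"
  note fD = bounded_module_mapD[OF f]
  have "(\<lambda>n. f n (act z a)) \<longlonglongrightarrow> 0" if "z \<in> F" for z a
  proof -
    have "(\<lambda>n. norm (f n z) * norm a) \<longlonglongrightarrow> 0"
      by (intro tendsto_mult_left_zero tendsto_norm_zero lim that)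
    then show ?thesis
      by (intro Lim_null_comparison[OF always_eventually, of "\<lambda>n. f n (act z a)"])
        (simp_all add: fD norm_act_le)
  qed
  then have "{act z a |z a. z \<in> F} \<subseteq> ?D" by blast
  moreover have "complex_vector.subspace ?D"
  proof (rule complex_vector.subspaceI)
    show "x + y \<in> ?D" if "x \<in> ?D" "y \<in> ?D" for x y
      using that tendsto_add[of "\<lambda>n. f n x" 0 sequentially "\<lambda>n. f n y" 0]
      by (simp add: linear_add[OF fD(2)])
    show "c *\<^sub>C x \<in> ?D" if "x \<in> ?D" for c x
      using that bounded_linear.tendsto_zero[OF bounded_linear_scaleC, of "\<lambda>n. f n x" sequentially c]
      by (simp add: fD)
  qed (simp add: linear_0[OF fD(2)])
  ultimately have "cspan {act z a |z a. z \<in> F} \<subseteq> ?D" by (rule complex_vector.span_minimal)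
  then have "closure (cspan {act z a |z a. z \<in> F}) \<subseteq> ?D"
    by (intro closure_minimal closed_contractions_tendsto_zero fD le)
  then show ?thesis using gen by auto
qed

theorem theorem6p8:
  fixes act :: "'h::complex_banach \<Rightarrow> 'a::cstar_algebra \<Rightarrow> 'h"
    and ip :: "'h \<Rightarrow> 'h \<Rightarrow> 'a"
    and act1 :: "'h1::complex_banach \<Rightarrow> 'a \<Rightarrow> 'h1"
    and ip1 :: "'h1 \<Rightarrow> 'h1 \<Rightarrow> 'a"
    and act2 :: "'h2::complex_banach \<Rightarrow> 'a \<Rightarrow> 'h2"
    and ip2 :: "'h2 \<Rightarrow> 'h2 \<Rightarrow> 'a"
    and \<phi> :: "'h \<Rightarrow> 'h1"
    and s :: "'h2 \<Rightarrow> 'h1"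
  assumes "sigma_unital TYPE('a)"
    and "hilbert_module act ip"
    and "countably_generated act"
    and "hilbert_module act1 ip1"
    and "hilbert_module act2 ip2"
    and "bounded_module_map act act1 \<phi>"
    and "bounded_module_map act2 act1 s"
    and "surj s"
  shows "\<exists>\<psi> :: nat \<Rightarrow> 'h \<Rightarrow> 'h2.
    (\<forall>n. bounded_module_map act act2 (\<psi> n)) \<and>
    (\<forall>x. (\<lambda>n. norm ((s \<circ> \<psi> n) x - \<phi> x)) \<longlonglongrightarrow> 0)"
proof -
  interpret H: hilbert_module act ip by fact
  interpret H2: hilbert_module act2 ip2 by fact
  note \<phi> = bounded_module_mapD[OF assms(6)] and s = bounded_module_mapD[OF assms(7)]
  obtain F where F: "countable F" "closure (cspan {act z a |z a. z \<in> F}) = UNIV"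
    using assms(3) by (auto simp: countably_generated_def)
  \<comment> \<open>Inserting 0 makes the enumerated set nonempty, so that
    \<open>from_nat_into\<close> ranges over all of it.\<close>
  define g where "g = from_nat_into (insert 0 F)"
  have g: "F \<subseteq> range g" using F(1) by (simp add: g_def range_from_nat_into subset_insertI)
  define x where "x i = (1 / (1 + norm (g i))) *\<^sub>R g i" for i
  have x: "norm (x i) \<le> 1" for i
    by (simp add: x_def divide_simps not_less add_nonneg_nonneg)
  have gx: "g i = (1 + norm (g i)) *\<^sub>R x i" for i
    using norm_ge_zero[of "g i"] by (simp add: x_def add_nonneg_eq_0_iff)
  \<comment> \<open>Any preimages do, however large: each \<open>L n\<close> below is a finite sum
    of rank one maps and hence bounded.\<close>
  define w where "w i = inv s (\<phi> (x i))" for i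
  have w: "s (w i) = \<phi> (x i)" for i
    using \<open>surj s\<close> by (simp add: w_def surj_f_inv_f)
  define C where "C = H.avg_compl x"
  \<comment> \<open>The square makes the bound \<open>2 * real (Suc n) / real (m n)\<close> equal to
    \<open>2 / real (Suc n)\<close>, which tends to 0.\<close>
  define m where "m n = (Suc n)\<^sup>2" for n
  define M where "M n = cesaro_mean (C n) (m n)" for n
  have C: "bounded_module_map act act (C n)" "norm (C n z) \<le> norm z" for n z
    using H.bounded_module_map_avg_compl H.norm_avg_compl_le[OF x] by (auto simp: C_def)
  have M_module: "bounded_module_map act act (M n)" for n
    unfolding M_def cesaro_mean_def
    by (intro H.bounded_module_map_scaleR H.bounded_module_map_sum bounded_module_map_funpow C)
  have M_le: "norm (M n z) \<le> norm z" for n z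
    unfolding M_def by (intro norm_cesaro_mean_le C)
  have M_lim_gen: "(\<lambda>n. M n (g i)) \<longlonglongrightarrow> 0" for i
  proof -
    have "(\<lambda>n. sqrt (2 / real (Suc n))) \<longlonglongrightarrow> sqrt 0"
      by (intro tendsto_real_sqrt LIMSEQ_Suc lim_const_over_n)
    then have lim: "(\<lambda>n. sqrt (2 / real (Suc n))) \<longlonglongrightarrow> 0" by simp
    have "norm (M n (x i)) \<le> sqrt (2 / real (Suc n))" if "n \<ge> i" for n
    proof (rule real_le_rsqrt)
      have "2 * real (Suc n) / real (m n) = 2 / real (Suc n)"
        by (simp add: m_def power2_eq_square del: of_nat_Suc mult_Suc mult_Suc_right)
      then show "(norm (M n (x i)))\<^sup>2 \<le> 2 / real (Suc n)"
        using H.norm_cesaro_mean_avg_compl_le[of x, OF x that, where m = "m n"]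
        by (simp only: M_def C_def)
    qed
    then have "(\<lambda>n. M n (x i)) \<longlonglongrightarrow> 0"
      by (intro Lim_null_comparison[OF _ lim]) (auto simp: eventually_sequentially)
    then have "(\<lambda>n. (1 + norm (g i)) *\<^sub>R M n (x i)) \<longlonglongrightarrow> 0"
      by (auto intro: tendsto_eq_intros)
    moreover have "M n (g i) = (1 + norm (g i)) *\<^sub>R M n (x i)" for n
      by (subst gx) (rule linear_scale[OF bounded_module_mapD(2)[OF M_module]])
    ultimately show ?thesis by simp
  qed
  have M_lim: "(\<lambda>n. M n z) \<longlonglongrightarrow> 0" for z
  proof (rule countably_generated_contractions_tendsto_zero[OF assms(2) F(2) M_module M_le])
    fix y assume "y \<in> F"
    then obtain i where "y = g i" using g by blast
    then show "(\<lambda>n. M n y) \<longlonglongrightarrow> 0" using M_lim_gen by simp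
  qed
  define L where "L n z = (1 / real (Suc n)) *\<^sub>R (\<Sum>i\<le>n. act2 (w i) (ip (x i) z))" for n z
  \<comment> \<open>Since \<open>1 - C ^ j\<close> is the sum of \<open>(1 - C) C ^ l\<close> over
    \<open>l < j\<close>, averaging over \<open>j < m n\<close> gives \<open>1 - M\<close>. As
    \<open>L n\<close> lifts \<phi> composed with \<open>1 - C n\<close>, the map
    \<open>\<psi> n\<close> lifts \<phi> composed with \<open>1 - M n\<close>.\<close>
  define \<psi> where "\<psi> n z = (1 / real (m n)) *\<^sub>R (\<Sum>j<m n. \<Sum>l<j. L n ((C n ^^ l) z))" for n z
  have L_module: "bounded_module_map act act2 (L n)" for n
    unfolding L_def
    by (intro H2.bounded_module_map_scaleR H2.bounded_module_map_sum
        bounded_module_map_rank_one[OF assms(2) assms(5)])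
  have "bounded_module_map act act2 (\<psi> n)" for n
    unfolding \<psi>_def
    by (intro H2.bounded_module_map_scaleR H2.bounded_module_map_sum
        bounded_module_map_compose[OF L_module] bounded_module_map_funpow C)
  moreover have "(\<lambda>n. norm ((s \<circ> \<psi> n) z - \<phi> z)) \<longlonglongrightarrow> 0" for z
  proof -
    have sL: "s (L n z) = \<phi> (z - C n z)" for n z
      by (simp only: L_def C_def H.diff_avg_compl linear_scale[OF s(2)] linear_sum[OF s(2)]
          linear_scale[OF \<phi>(2)] linear_sum[OF \<phi>(2)] s(4) \<phi>(4) w)
    have "s (\<psi> n z) = \<phi> (z - M n z)" for n
    proof -
      have "(\<Sum>l<j. (C n ^^ l) z - C n ((C n ^^ l) z)) = z - (C n ^^ j) z" for j
        using sum_lessThan_telescope'[of "\<lambda>l. (C n ^^ l) z" j] by simp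
      then have "s (\<psi> n z) = (1 / real (m n)) *\<^sub>R (\<Sum>j<m n. \<phi> (z - (C n ^^ j) z))"
        by (simp add: \<psi>_def linear_scale[OF s(2)] linear_sum[OF s(2)] sL flip: linear_sum[OF \<phi>(2)])
      also have "\<dots> = \<phi> ((1 / real (m n)) *\<^sub>R (\<Sum>j<m n. z - (C n ^^ j) z))"
        by (simp only: linear_scale[OF \<phi>(2)] linear_sum[OF \<phi>(2)])
      \<comment> \<open>Here \<open>m n\<close> is nonzero, so the mean of the constant
        \<open>z\<close> is \<open>z\<close>.\<close>
      also have "(1 / real (m n)) *\<^sub>R (\<Sum>j<m n. z - (C n ^^ j) z) = z - M n z"
        by (simp add: M_def cesaro_mean_def sum_subtractf scaleR_diff_right sum_constant_scaleR m_def)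
      finally show ?thesis .
    qed
    then have "norm ((s \<circ> \<psi> n) z - \<phi> z) = norm (\<phi> (M n z))" for n
      by (simp add: linear_diff[OF \<phi>(2)])
    then show ?thesis
      using tendsto_norm_zero[OF bounded_linear.tendsto_zero[OF \<phi>(1) M_lim]] by simp
  qed
  ultimately show ?thesis by blast
qed

end
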